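(* Let $1 \le p < \infty$ and let $\mathcal X, \mathcal Y, \mathcal Z$ be Polish metric spaces. Let $D$ be the set of pairs $(\mu,\nu) \in \mathscr P_p(\mathcal X \times \mathcal Y) \times \mathscr P_p(\mathcal Y \times \mathcal Z)$ such that the $\mathcal Y$-marginals of $\mu$ and $\nu$ coincide, with the topology inherited from the product of the $p$-Wasserstein topologies, and consider the map $\dot\otimes : D \to \mathscr P_p(\mathcal X \times \mathcal Y \times \mathcal Z)$, $(\mu,\nu) \mapsto \mu \mathbin{\dot\otimes} \nu$, with the target carrying the $p$-Wasserstein metric. If $(\mu,\nu) \in D$ and $\nu \in \mathscr F_p(\mathcal Y \rightsquigarrow \mathcal Z)$, then $\dot\otimes$ is continuous at $(\mu,\nu)$.
   Context: Fix $1 \le p < \infty$. A Polish metric space is a complete separable metric space $(\mathcal X,\rho_{\mathcal X})$ (metrics need not be bounded). Products of Polish metric spaces carry the metric $\rho_{\mathcal X \times \mathcal Y}((x_1,y_1),(x_2,y_2)) := (\rho_{\mathcal X}(x_1,x_2)^p + \rho_{\mathcal Y}(y_1,y_2)^p)^{1/p}$ (associative, hence extends to finite products). $\mathscr P_p(\mathcal X)$ is the set of Borel probability measures $\mu$ on $\mathcal X$ with $\int \rho_{\mathcal X}(x_0,x)^p\, d\mu(x) < \infty$ for some (equivalently all) $x_0$, with the $p$-Wasserstein metric $\mathcal W_p(\mu_1,\mu_2) = (\inf_{\gamma} \int \rho_{\mathcal X}(x_1,x_2)^p\, d\gamma(x_1,x_2))^{1/p}$, the infimum being over couplings $\gamma$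 of $\mu_1,\mu_2$. $\mathscr F_p(\mathcal Y \rightsquigarrow \mathcal Z)$ is the set of $\nu \in \mathscr P_p(\mathcal Y \times \mathcal Z)$ which are concentrated on the graph of some Borel function $\mathcal Y \to \mathcal Z$. Conditionally independent product: for $\mu \in \mathscr P_p(\mathcal X \times \mathcal Y)$ and $\nu \in \mathscr P_p(\mathcal Y \times \mathcal Z)$ with the same $\mathcal Y$-marginal, $\mu \mathbin{\dot\otimes} \nu$ is the probability measure on $\mathcal X \times \mathcal Y \times \mathcal Z$ given by $\int f \, d(\mu \mathbin{\dot\otimes} \nu) = \iint f(x,y,z)\, d\nu_y(z)\, d\mu(x,y)$, where $y \mapsto \nu_y$ is a disintegration of $\nu$ with respect to its $\mathcal Y$-coordinate. *)

theory Defs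
  imports "HOL-Probability.Probability"
begin

text \<open>
  A Polish metric space is a type of class \<open>polish_space\<close>, which is a (complete, second
  countable) metric space. The library metric on a product type is the \<open>\<ell>\<^sup>2\<close> product,
  so the \<open>\<ell>\<^sup>p\<close> product metric is a separate function, and the metric is an explicit parameter
  \<open>d\<close> of the notions below. All these metrics induce the product topology, whose Borel sets are
  those of \<open>borel\<close>.
\<close>

definition lp_dist ::
    "real \<Rightarrow> ('a \<Rightarrow> 'a \<Rightarrow> real) \<Rightarrow> ('b \<Rightarrow> 'b \<Rightarrow> real) \<Rightarrow> 'a \<times> 'b \<Rightarrow> 'a \<times> 'b \<Rightarrow> real" where
  "lp_dist p d e = (\<lambda>(x1, y1) (x2, y2). (d x1 x2 powr p + e y1 y2 powr p) powr (1 / p))"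

definition Pp :: "real \<Rightarrow> ('a \<Rightarrow> 'a \<Rightarrow> real) \<Rightarrow> 'a::topological_space measure set" where
  "Pp p d = {\<mu>. sets \<mu> = sets borel \<and> prob_space \<mu> \<and>
                 (\<exists>x0. (\<integral>\<^sup>+x. ennreal (d x0 x powr p) \<partial>\<mu>) < \<infinity>)}"

definition couplings ::
    "'a::topological_space measure \<Rightarrow> 'a measure \<Rightarrow> ('a \<times> 'a) measure set" where
  "couplings \<mu>1 \<mu>2 = {\<gamma>. sets \<gamma> = sets borel \<and> prob_space \<gamma> \<and>
                          distr \<gamma> borel fst = \<mu>1 \<and> distr \<gamma> borel snd = \<mu>2}"

text \<open>
  The infimum is taken in the extended nonnegative reals; it is finite for arguments in
  \<open>Pp p d\<close>, which are the only ones for which \<open>Wp\<close> is meaningful.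
\<close>

definition Wp ::
    "real \<Rightarrow> ('a \<Rightarrow> 'a \<Rightarrow> real) \<Rightarrow> 'a::topological_space measure \<Rightarrow> 'a measure \<Rightarrow> real" where
  "Wp p d \<mu>1 \<mu>2 =
     enn2real (INF \<gamma>\<in>couplings \<mu>1 \<mu>2. \<integral>\<^sup>+(x1, x2). ennreal (d x1 x2 powr p) \<partial>\<gamma>) powr (1 / p)"

definition Wp_topology ::
    "real \<Rightarrow> ('a \<Rightarrow> 'a \<Rightarrow> real) \<Rightarrow> 'a::topological_space measure topology" where
  "Wp_topology p d = Metric_space.mtopology (Pp p d) (Wp p d)"

definition Fp ::
    "real \<Rightarrow> ('b \<Rightarrow> 'b \<Rightarrow> real) \<Rightarrow> ('c \<Rightarrow> 'c \<Rightarrow> real) \<Rightarrow>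
     ('b::topological_space \<times> 'c::topological_space) measure set" where
  "Fp p d e = {\<nu> \<in> Pp p (lp_dist p d e). \<exists>f \<in> borel \<rightarrow>\<^sub>M borel. AE (y, z) in \<nu>. z = f y}"

definition disintegration ::
    "('b::topological_space \<times> 'c::topological_space) measure \<Rightarrow> ('b \<Rightarrow> 'c measure) \<Rightarrow> bool" where
  "disintegration \<nu> \<kappa> \<longleftrightarrow> \<kappa> \<in> borel \<rightarrow>\<^sub>M prob_algebra borel \<and>
     \<nu> = distr \<nu> borel fst \<bind> (\<lambda>y. distr (\<kappa> y) borel (Pair y))"

text \<open>
  Disintegrations of a probability measure on a product of Polish spaces exist and are unique
  almost everywhere with respect to its first marginal, so the choice below is immaterial if
  that marginal is the second marginal of \<open>\<mu>\<close>.
\<close>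

definition ci_prod ::
    "('a::topological_space \<times> 'b::topological_space) measure \<Rightarrow>
     ('b \<times> 'c::topological_space) measure \<Rightarrow> ('a \<times> 'b \<times> 'c) measure" where
  "ci_prod \<mu> \<nu> = (let \<kappa> = (SOME \<kappa>. disintegration \<nu> \<kappa>)
                  in \<mu> \<bind> (\<lambda>(x, y). distr (\<kappa> y) borel (\<lambda>z. (x, y, z))))"

lemma nn_integral_ci_prod:
  fixes \<mu> :: "('a::polish_space \<times> 'b::polish_space) measure"
    and \<nu> :: "('b \<times> 'c::polish_space) measure"
  assumes \<mu>: "sets \<mu> = sets borel" and ex: "\<exists>\<kappa>. disintegration \<nu> \<kappa>"
  obtains \<kappa> where "disintegration \<nu> \<kappa>"
    "\<And>f. f \<in> borel_measurable borel \<Longrightarrow>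
       (\<integral>\<^sup>+w. f w \<partial>ci_prod \<mu> \<nu>) = (\<integral>\<^sup>+(x, y). (\<integral>\<^sup>+z. f (x, y, z) \<partial>\<kappa> y) \<partial>\<mu>)"
proof -
  define \<kappa> where "\<kappa> = (SOME \<kappa>. disintegration \<nu> \<kappa>)"
  have dis: "disintegration \<nu> \<kappa>"
    unfolding \<kappa>_def using ex by (rule someI_ex)
  then have \<kappa> [measurable]: "\<kappa> \<in> borel \<rightarrow>\<^sub>M subprob_algebra borel"
    by (auto simp: disintegration_def intro: measurable_prob_algebraD)
  have [measurable_cong]: "sets \<mu> = sets (borel \<Otimes>\<^sub>M borel :: ('a \<times> 'b) measure)"
    using \<mu> by (simp only: borel_prod)
  have sets_\<kappa>: "sets (\<kappa> y) = sets borel" for y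
    using measurable_space[OF \<kappa>, of y] by (simp add: space_subprob_algebra)
  have K: "(\<lambda>(x, y). distr (\<kappa> y) borel (\<lambda>z. (x, y, z))) \<in> \<mu> \<rightarrow>\<^sub>M subprob_algebra borel"
    unfolding case_prod_beta
    by (rule measurable_distr2[where M = borel]) (simp_all add: borel_prod[symmetric])
  have "(\<integral>\<^sup>+w. f w \<partial>ci_prod \<mu> \<nu>) = (\<integral>\<^sup>+(x, y). (\<integral>\<^sup>+z. f (x, y, z) \<partial>\<kappa> y) \<partial>\<mu>)"
    if f: "f \<in> borel_measurable borel" for f
  proof -
    have "(\<lambda>z. (x, y, z)) \<in> \<kappa> y \<rightarrow>\<^sub>M borel" for x :: 'a and y
      unfolding measurable_cong_sets[OF sets_\<kappa> refl] by (simp add: borel_prod[symmetric])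
    then show ?thesis
      unfolding ci_prod_def Let_def \<kappa>_def[symmetric] nn_integral_bind[OF f K]
      by (intro nn_integral_cong) (auto simp: nn_integral_distr f)
  qed
  with dis show thesis by (rule that)
qed

definition ci_dom ::
    "real \<Rightarrow> ('a \<Rightarrow> 'a \<Rightarrow> real) \<Rightarrow> ('b \<Rightarrow> 'b \<Rightarrow> real) \<Rightarrow> ('c \<Rightarrow> 'c \<Rightarrow> real) \<Rightarrow>
     (('a::topological_space \<times> 'b::topological_space) measure \<times>
      ('b \<times> 'c::topological_space) measure) set" where
  "ci_dom p dX dY dZ =
     {(\<mu>, \<nu>). \<mu> \<in> Pp p (lp_dist p dX dY) \<and> \<nu> \<in> Pp p (lp_dist p dY dZ) \<and>
              distr \<mu> borel snd = distr \<nu> borel fst}"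

end

theory Submission
  imports Defs
begin

text \<open>
  Let \<open>\<nu>\<close> be concentrated on the graph of \<open>f\<close>, and let \<open>(\<mu>', \<nu>')\<close> be near \<open>(\<mu>, \<nu>)\<close>. The product of \<open>\<mu>\<close>
  and \<open>\<nu>\<close> is the law of \<open>(x, y, f y)\<close> with \<open>(x, y) \<sim> \<mu>\<close>. Draw \<open>((x, y), (x', y'))\<close> from a cheap coupling
  of \<open>\<mu>\<close> and \<open>\<mu>'\<close>, draw \<open>z'\<close> from the kernel of \<open>\<nu>'\<close> at \<open>y'\<close>, and draw \<open>(y'', z'')\<close> so that
  \<open>((y'', z''), (y', z'))\<close> is a cheap coupling of \<open>\<nu>\<close> and \<open>\<nu>'\<close>. Then \<open>(x', y', z')\<close> has the law of the
  product of \<open>\<mu>'\<close> and \<open>\<nu>'\<close>, and \<open>((x, y, f y), (x', y', z'))\<close> is a coupling of the two products. Its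
  cost is small apart from the distance of \<open>f y\<close> and \<open>z'\<close>. Now \<open>z'\<close> is near \<open>z'' = f y''\<close>, and \<open>y\<close> and
  \<open>y''\<close> are both near \<open>y'\<close>, hence near each other (\<open>transport_cost_ci_prod_le\<close>).

  What remains is a statement about one measure \<open>m\<close>, the common marginal on the middle space, and one
  Borel function \<open>f\<close> with finite \<open>p\<close>-th moment: a coupling of \<open>m\<close> with itself that moves points little
  moves the values of \<open>f\<close> little (\<open>coupling_moves_function_small\<close>). Continuity of \<open>f\<close> is not
  available, but both coordinates have the same law \<open>m\<close>: regularity of \<open>m\<close> shows that such a
  coupling rarely leaves a given Borel set (\<open>coupling_leaves_set_small\<close>), which gives smallness in
  measure, and the finite moment gives uniform integrability.

  Two prerequisites carry the rest of the work. Disintegrations exist on products of Polish spaces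
  (\<open>disintegration_exists\<close>), by coding the second factor into the real line and regularising
  conditional distribution functions; this makes \<open>ci_prod\<close> meaningful and turns it into the tool for
  gluing couplings. And \<open>Wp\<close> is a metric for every metric that induces the given topology
  (\<open>Metric_space_Wp\<close>), so that continuity can be checked with balls.
\<close>

section \<open>Coding Polish spaces by real numbers\<close>

instance prod :: (polish_space, polish_space) polish_space ..

text \<open>
  In base 4 with digits 0 and 1 there is no ambiguity of the kind 0.0111\<dots> = 0.1, so a digit
  is recovered from the integer part of a shifted number; this makes decoding Borel measurable.
\<close>

definition digit_sum :: "(nat \<Rightarrow> bool) \<Rightarrow> real" where
  "digit_sum b = (\<Sum>j. of_bool (b j) / 4 ^ Suc j)"

lemma summable_digits: "summable (\<lambda>j. of_bool (b j) / 4 ^ Suc j :: real)"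
proof (rule summable_comparison_test')
  show "summable (\<lambda>j. (1/4) ^ Suc j :: real)"
    by (subst summable_Suc_iff) (rule summable_geometric, simp)
qed (auto simp: field_simps)

lemma digit_sum_bounds: "0 \<le> digit_sum b" "digit_sum b < 1"
proof -
  show "0 \<le> digit_sum b"
    unfolding digit_sum_def by (intro suminf_nonneg summable_digits) auto
  have "(\<lambda>j. (1/4) ^ Suc j :: real) sums ((1/4) * (1 / (1 - 1/4)))"
    unfolding power_Suc by (intro sums_mult geometric_sums) simp
  then have *: "(\<lambda>j. (1/4) ^ Suc j :: real) sums (1/3)" by simp
  have "digit_sum b \<le> (\<Sum>j. (1/4) ^ Suc j)"
    unfolding digit_sum_def
    by (intro suminf_le summable_digits sums_summable[OF *]) (auto simp: field_simps)
  also have "\<dots> = 1/3" using * by (rule sums_unique[symmetric])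
  finally show "digit_sum b < 1" by simp
qed

text \<open>
  After the shift, the digits before position \<open>i\<close> contribute multiples of 4, the digit at position \<open>i\<close>
  contributes itself, and the later digits contribute less than 1.
\<close>

lemma odd_floor_digit_sum: "odd \<lfloor>4 ^ Suc i * digit_sum b\<rfloor> \<longleftrightarrow> b i"
proof -
  define n :: int where "n = (\<Sum>j<i. of_bool (b j) * 4 ^ (i - j)) + of_bool (b i)"
  have "digit_sum b = (\<Sum>j. of_bool (b (j + Suc i)) / 4 ^ Suc (j + Suc i)) + (\<Sum>j<Suc i. of_bool (b j) / 4 ^ Suc j)"
    unfolding digit_sum_def by (rule suminf_split_initial_segment[OF summable_digits])
  also have "(\<Sum>j. of_bool (b (j + Suc i)) / 4 ^ Suc (j + Suc i) :: real) =
      (\<Sum>j. (1 / 4 ^ Suc i) * (of_bool (b (j + Suc i)) / 4 ^ Suc j))"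
    by (intro arg_cong[where f = suminf] ext) (simp add: power_add field_simps)
  also have "\<dots> = (1 / 4 ^ Suc i) * digit_sum (\<lambda>j. b (j + Suc i))"
    unfolding digit_sum_def by (rule suminf_mult[OF summable_digits])
  finally have "4 ^ Suc i * digit_sum b =
      digit_sum (\<lambda>j. b (j + Suc i)) + 4 ^ Suc i * (\<Sum>j<Suc i. of_bool (b j) / 4 ^ Suc j)"
    by (simp add: field_simps)
  also have "4 ^ Suc i * (\<Sum>j<Suc i. of_bool (b j) / 4 ^ Suc j :: real) = of_int n"
  proof -
    have "4 ^ Suc i * (\<Sum>j<i. of_bool (b j) / 4 ^ Suc j :: real) = (\<Sum>j<i. of_bool (b j) * 4 ^ (i - j))"
      unfolding sum_distrib_left by (intro sum.cong refl) (simp add: power_diff field_simps)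
    then show ?thesis by (simp add: n_def distrib_left)
  qed
  finally have "\<lfloor>4 ^ Suc i * digit_sum b\<rfloor> = n"
    using digit_sum_bounds[of "\<lambda>j. b (j + Suc i)"] by linarith
  moreover have "even (\<Sum>j<i. of_bool (b j) * 4 ^ (i - j) :: int)"
    by (intro dvd_sum) auto
  ultimately show ?thesis by (simp add: n_def)
qed

lemma borel_measurable_digit_sum [measurable (raw)]:
  assumes [measurable]: "\<And>i. Measurable.pred M (\<lambda>x. b x i)"
  shows "(\<lambda>x. digit_sum (b x)) \<in> borel_measurable M"
  unfolding digit_sum_def by measurable

text \<open>
  This reduces kernels on Polish spaces to kernels on the real line. A point is coded by the answers
  to the countably many questions "is it within \<open>2\<^sup>-\<^sup>k\<close> of the \<open>n\<close>-th point of a dense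
  sequence?", stored as digits. Decoding takes for each \<open>k\<close> the first \<open>n\<close> with a positive answer;
  these dense points converge to the coded point. A measurable left inverse is all that is asked of the
  decoding, since a kernel on the codes is pushed forward along it.
\<close>

lemma real_coding:
  obtains \<phi> :: "'a::polish_space \<Rightarrow> real" and \<psi> :: "real \<Rightarrow> 'a"
  where "\<phi> \<in> borel_measurable borel" "\<psi> \<in> borel_measurable borel"
    "\<And>x. \<psi> (\<phi> x) = x" "\<And>x. 0 \<le> \<phi> x" "\<And>x. \<phi> x < 1"
proof -
  obtain S :: "'a set" where S: "countable S" "\<And>U. open U \<Longrightarrow> U \<noteq> {} \<Longrightarrow> \<exists>s\<in>S. s \<in> U"
    using countable_dense_exists by blast
  have "S \<noteq> {}" using S(2)[of UNIV] by auto
  define D where "D = from_nat_into S"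
  have dense: "\<exists>n. dist (D n) x < e" if e: "e > 0" for x e
  proof -
    obtain s where "s \<in> S" "s \<in> ball x e" using S(2)[of "ball x e"] e by auto
    then show ?thesis using S(1) \<open>S \<noteq> {}\<close> unfolding D_def
      by (metis dist_commute from_nat_into_surj mem_ball)
  qed
  define b where "b x i = (case prod_decode i of (k, n) \<Rightarrow> dist (D n) x < (1/2) ^ k)" for x i
  define bit where "bit r i = odd \<lfloor>4 ^ Suc i * r\<rfloor>" for r :: real and i
  define near where "near r k = (LEAST n. bit r (prod_encode (k, n)))" for r k
  define \<phi> where "\<phi> x = digit_sum (b x)" for x
  \<comment> \<open>off the range of the coding the approximations need not converge, and \<open>D 0\<close> is a default value\<close>
  define \<psi> where "\<psi> r = (if convergent (\<lambda>k. D (near r k)) then lim (\<lambda>k. D (near r k)) else D 0)" for r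
  have bit: "bit (\<phi> x) (prod_encode (k, n)) \<longleftrightarrow> dist (D n) x < (1/2) ^ k" for x k n
    by (simp add: bit_def \<phi>_def odd_floor_digit_sum b_def del: power_Suc)
  have lim: "(\<lambda>k. D (near (\<phi> x) k)) \<longlonglongrightarrow> x" for x
  proof (rule metric_tendsto_imp_tendsto)
    show "(\<lambda>k. (1/2) ^ k :: real) \<longlonglongrightarrow> 0" by (rule LIMSEQ_power_zero) simp
    have "dist (D (near (\<phi> x) k)) x < (1/2) ^ k" for k
      unfolding near_def bit
      using LeastI_ex[of "\<lambda>n. dist (D n) x < (1/2) ^ k"] dense[of "(1/2) ^ k" x] by simp
    then show "\<forall>\<^sub>F k in sequentially. dist (D (near (\<phi> x) k)) x \<le> dist ((1/2) ^ k :: real) 0"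
      by (auto intro!: always_eventually less_imp_le)
  qed
  have near [measurable]: "(\<lambda>r. near r k) \<in> borel \<rightarrow>\<^sub>M count_space UNIV" for k
    unfolding near_def bit_def by measurable
  have Dn: "(\<lambda>r. D (near r k)) \<in> borel_measurable borel" for k
    by (rule measurable_compose[OF near]) simp
  have "\<phi> \<in> borel_measurable borel"
    unfolding \<phi>_def b_def case_prod_beta by measurable
  moreover have "\<psi> \<in> borel_measurable borel"
  proof (rule borel_measurable_LIMSEQ_metric)
    let ?C = "{r. convergent (\<lambda>k. D (near r k))}"
    have "?C = {r \<in> space borel. Cauchy (\<lambda>k. D (near r k))}"
      by (simp add: Cauchy_convergent_iff)
    also have "\<dots> \<in> sets borel"
      unfolding metric_Cauchy_iff2 using Dn by measurable
    finally have C [measurable]: "?C \<in> sets borel" .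
    show "(\<lambda>r. if r \<in> ?C then D (near r k) else D 0) \<in> borel_measurable borel" for k
      using Dn by measurable
    show "(\<lambda>k. if r \<in> ?C then D (near r k) else D 0) \<longlonglongrightarrow> \<psi> r" for r
      by (auto simp: \<psi>_def convergent_LIMSEQ_iff)
  qed
  moreover have "\<psi> (\<phi> x) = x" for x
    using lim[of x] by (auto simp: \<psi>_def convergent_def limI)
  ultimately show thesis
    using digit_sum_bounds by (intro that[of \<phi> \<psi>]) (auto simp: \<phi>_def)
qed

section \<open>Disintegration on products of Polish spaces\<close>

lemma borel_measurable_fst' [measurable (raw)]:
  fixes f :: "'a \<Rightarrow> 'b::topological_space \<times> 'c::topological_space"
  assumes "f \<in> borel_measurable M" shows "(\<lambda>x. fst (f x)) \<in> borel_measurable M"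
  by (rule measurable_compose[OF assms borel_measurable_continuous_onI]) (intro continuous_intros)

lemma borel_measurable_snd' [measurable (raw)]:
  fixes f :: "'a \<Rightarrow> 'b::topological_space \<times> 'c::topological_space"
  assumes "f \<in> borel_measurable M" shows "(\<lambda>x. snd (f x)) \<in> borel_measurable M"
  by (rule measurable_compose[OF assms borel_measurable_continuous_onI]) (intro continuous_intros)

lemma AE_le_of_nn_integral_le:
  assumes [measurable]: "f \<in> borel_measurable M" "g \<in> borel_measurable M"
    and fin: "(\<integral>\<^sup>+x. f x \<partial>M) < \<infinity>"
    and le: "\<And>A. A \<in> sets M \<Longrightarrow> (\<integral>\<^sup>+x\<in>A. f x \<partial>M) \<le> (\<integral>\<^sup>+x\<in>A. g x \<partial>M)"
  shows "AE x in M. f x \<le> g x"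
proof -
  let ?A = "{x \<in> space M. g x < f x}"
  have [measurable]: "?A \<in> sets M" by measurable
  have "(\<integral>\<^sup>+x\<in>?A. g x \<partial>M) \<le> (\<integral>\<^sup>+x. f x \<partial>M)"
    by (intro nn_integral_mono) (auto simp: indicator_def)
  then have gfin: "(\<integral>\<^sup>+x\<in>?A. g x \<partial>M) \<noteq> \<infinity>" using fin by (auto simp: top_unique)
  have "(\<integral>\<^sup>+x. f x * indicator ?A x - g x * indicator ?A x \<partial>M) =
      (\<integral>\<^sup>+x\<in>?A. f x \<partial>M) - (\<integral>\<^sup>+x\<in>?A. g x \<partial>M)"
    by (rule nn_integral_diff[OF _ _ gfin]) (auto simp: indicator_def)
  also have "\<dots> = 0" using le[of ?A] gfin by (intro diff_eq_0_ennreal) (auto simp: less_top[symmetric] top_unique)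
  finally have "AE x in M. f x * indicator ?A x - g x * indicator ?A x = 0"
    by (subst (asm) nn_integral_0_iff_AE) auto
  then show ?thesis
    using AE_space
  proof eventually_elim
    fix x assume "f x * indicator ?A x - g x * indicator ?A x = 0" "x \<in> space M"
    then show "f x \<le> g x"
      using ennreal_minus_eq_0[of "f x" "g x"] by (cases "g x < f x") auto
  qed
qed

text \<open>
  For each threshold separately, \<open>g q y\<close> is a version of the conditional probability that the
  second coordinate is at most \<open>q\<close>, given that the first one is \<open>y\<close>: a Radon--Nikodym derivative,
  which is at most 1 almost everywhere. For fixed \<open>y\<close> it need not be monotone in \<open>q\<close>. Below 0 and from
  1 on, the values are prescribed for every \<open>y\<close>, so that the distribution functions made from
  them have the right limits at infinity for every \<open>y\<close>.
\<close>

lemma conditional_cdf_values: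
  fixes \<rho> :: "('b::polish_space \<times> real) measure"
  assumes \<rho>: "sets \<rho> = sets borel" and "prob_space \<rho>"
    and supp: "AE w in \<rho>. 0 \<le> snd w \<and> snd w < 1"
  obtains g :: "real \<Rightarrow> 'b \<Rightarrow> real" where
    "\<And>q. g q \<in> borel_measurable borel" "\<And>q y. 0 \<le> g q y" "\<And>q y. g q y \<le> 1"
    "\<And>q y. q < 0 \<Longrightarrow> g q y = 0" "\<And>q y. 1 \<le> q \<Longrightarrow> g q y = 1"
    "\<And>q B. B \<in> sets borel \<Longrightarrow>
       (\<integral>\<^sup>+y\<in>B. ennreal (g q y) \<partial>distr \<rho> borel fst) = emeasure \<rho> (B \<times> {..q})"
proof -
  interpret \<rho>: prob_space \<rho> by fact
  define m where "m = distr \<rho> borel fst"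
  note [measurable_cong] = \<rho>
  have sm [measurable_cong, simp]: "sets m = sets borel" by (simp add: m_def)
  have sp [simp]: "space m = UNIV" "space \<rho> = UNIV"
    using sets_eq_imp_space_eq[OF sm] sets_eq_imp_space_eq[OF \<rho>] by simp_all
  have fst_m [measurable]: "fst \<in> \<rho> \<rightarrow>\<^sub>M borel" by measurable
  interpret m: prob_space m unfolding m_def by (rule \<rho>.prob_space_distr) simp
  have rect [measurable]: "B \<times> {..q} \<in> sets \<rho>" if "B \<in> sets borel" for B :: "'b set" and q
  proof -
    have "B \<times> {..q} = {w \<in> space \<rho>. fst w \<in> B \<and> snd w \<le> q}" by auto
    also have "\<dots> \<in> sets \<rho>" using that by measurable
    finally show ?thesis .
  qed
  have "\<forall>q. \<exists>g. g \<in> borel_measurable borel \<and> (\<forall>y. 0 \<le> g y \<and> g y \<le> 1) \<and>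
     (q < 0 \<longrightarrow> (\<forall>y. g y = 0)) \<and> (1 \<le> q \<longrightarrow> (\<forall>y. g y = 1)) \<and>
     (\<forall>B\<in>sets borel. (\<integral>\<^sup>+y\<in>B. ennreal (g y) \<partial>m) = emeasure \<rho> (B \<times> {..q}))"
    (is "\<forall>q. \<exists>g. ?P q g")
  proof
    fix q :: real
    consider "q < 0" | "1 \<le> q" | "0 \<le> q" "q < 1" by linarith
    then show "\<exists>g. ?P q g"
    proof cases
      case 1
      have "emeasure \<rho> (B \<times> {..q}) = 0" for B
      proof -
        have "AE w in \<rho>. w \<notin> B \<times> {..q}"
          using supp by eventually_elim (use 1 in auto)
        then show ?thesis using emeasure_eq_0_AE[of "\<lambda>w. w \<in> B \<times> {..q}" \<rho>] by simp
      qed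
      then show ?thesis using 1 by (intro exI[of _ "\<lambda>_. 0"]) auto
    next
      case 2
      have "emeasure \<rho> (B \<times> {..q}) = emeasure m B" if [measurable]: "B \<in> sets borel" for B
      proof -
        have "emeasure m B = emeasure \<rho> (fst -` B \<inter> space \<rho>)"
          unfolding m_def by (rule emeasure_distr) measurable
        also have "\<dots> = emeasure \<rho> (B \<times> {..q})"
        proof (rule emeasure_eq_AE)
          show "AE w in \<rho>. w \<in> fst -` B \<inter> space \<rho> \<longleftrightarrow> w \<in> B \<times> {..q}"
            using supp by eventually_elim (use 2 in auto)
        qed measurable
        finally show ?thesis ..
      qed
      then show ?thesis using 2 by (intro exI[of _ "\<lambda>_. 1"]) (auto simp: nn_integral_cmult_indicator)
    next
      case 3
      define N where "N = distr (density \<rho> (\<lambda>w. indicator {..q} (snd w))) borel fst"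
      have eN: "emeasure N B = emeasure \<rho> (B \<times> {..q})" if [measurable]: "B \<in> sets borel" for B
      proof -
        have pre: "fst -` B \<inter> space \<rho> \<in> sets \<rho>" by measurable
        have "emeasure N B = emeasure (density \<rho> (\<lambda>w. indicator {..q} (snd w))) (fst -` B \<inter> space \<rho>)"
          unfolding N_def by (subst emeasure_distr) simp_all
        also have "\<dots> = (\<integral>\<^sup>+w. indicator {..q} (snd w) * indicator (fst -` B \<inter> space \<rho>) w \<partial>\<rho>)"
          using pre by (intro emeasure_density) measurable
        also have "\<dots> = (\<integral>\<^sup>+w. indicator (B \<times> {..q}) w \<partial>\<rho>)"
          by (intro nn_integral_cong) (auto simp: indicator_def)
        finally show ?thesis by simp
      qed
      have Nm: "emeasure N B \<le> emeasure m B" if [measurable]: "B \<in> sets borel" for B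
      proof -
        have "fst -` B \<inter> space \<rho> \<in> sets \<rho>" by measurable
        then show ?thesis
          unfolding eN[OF that] m_def by (subst emeasure_distr) (auto intro!: emeasure_mono)
      qed
      have sN: "sets N = sets m" by (simp add: N_def)
      define h where "h = RN_deriv m N"
      have [measurable]: "h \<in> borel_measurable borel"
        unfolding h_def using borel_measurable_RN_deriv[of m N] by simp
      have "absolutely_continuous m N"
        unfolding absolutely_continuous_def
      proof
        fix A assume "A \<in> null_sets m"
        then show "A \<in> null_sets N" using Nm[of A] by (auto simp: null_sets_def sN)
      qed
      then have "density m h = N" unfolding h_def by (rule m.density_RN_deriv) fact
      then have h: "(\<integral>\<^sup>+y\<in>B. h y \<partial>m) = emeasure N B" if "B \<in> sets borel" for B
        using that emeasure_density[of h m B] by auto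
      have "AE y in m. h y \<le> 1"
      proof (rule AE_le_of_nn_integral_le)
        show "(\<integral>\<^sup>+x. h x \<partial>m) < \<infinity>"
          using h[of UNIV] Nm[of UNIV] m.emeasure_space_1 by (auto simp: less_top[symmetric] top_unique)
        show "(\<integral>\<^sup>+x\<in>A. h x \<partial>m) \<le> (\<integral>\<^sup>+x\<in>A. 1 \<partial>m)" if "A \<in> sets m" for A
          using h[of A] Nm[of A] that by simp
      qed simp_all
      then have "AE y in m. ennreal (enn2real (min 1 (h y))) = h y"
      proof eventually_elim
        fix y assume "h y \<le> 1"
        then have "h y < top" by (rule le_less_trans) simp
        with \<open>h y \<le> 1\<close> show "ennreal (enn2real (min 1 (h y))) = h y"
          by (simp add: min_absorb2)
      qed
      then have "(\<integral>\<^sup>+y\<in>B. ennreal (enn2real (min 1 (h y))) \<partial>m) = (\<integral>\<^sup>+y\<in>B. h y \<partial>m)" for B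
        by (intro nn_integral_cong_AE) (elim eventually_mono, simp)
      then show ?thesis using 3 h eN
        by (intro exI[of _ "\<lambda>y. enn2real (min 1 (h y))"]) (simp add: enn2real_leI)
    qed
  qed
  from choice[OF this] obtain g where "\<forall>q. ?P q (g q)" by (rule exE)
  then show thesis by (intro that[of g]) (auto simp: m_def)
qed

text \<open>
  The values at the rationals are made into a distribution function by taking the infimum over all
  rationals beyond the given point. That infimum is monotone and right-continuous for every \<open>y\<close>,
  whatever the values are, so that every \<open>y\<close> gets a probability measure. It still has the right
  integrals: it lies almost everywhere above the conditional probability at the point, and its
  integrals are at most those at any later rational, which converge by continuity from above.
\<close>

lemma real_disintegration:
  fixes \<rho> :: "('b::polish_space \<times> real) measure"
  assumes \<rho>: "sets \<rho> = sets borel" and "prob_space \<rho>"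
    and supp: "AE w in \<rho>. 0 \<le> snd w \<and> snd w < 1"
  shows "\<exists>\<kappa>. disintegration \<rho> \<kappa>"
proof -
  interpret \<rho>: prob_space \<rho> by fact
  obtain g :: "real \<Rightarrow> 'b \<Rightarrow> real" where
    g [measurable]: "\<And>q. g q \<in> borel_measurable borel" and
    g01: "\<And>q y. 0 \<le> g q y" "\<And>q y. g q y \<le> 1"
      "\<And>q y. q < 0 \<Longrightarrow> g q y = 0" "\<And>q y. 1 \<le> q \<Longrightarrow> g q y = 1" and
    gint: "\<And>q B. B \<in> sets borel \<Longrightarrow>
       (\<integral>\<^sup>+y\<in>B. ennreal (g q y) \<partial>distr \<rho> borel fst) = emeasure \<rho> (B \<times> {..q})"
    by (rule conditional_cdf_values[OF assms]) blast
  define m where "m = distr \<rho> borel fst"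
  note [measurable_cong] = \<rho>
  have sm [measurable_cong, simp]: "sets m = sets borel" by (simp add: m_def)
  have sp [simp]: "space m = UNIV" "space \<rho> = UNIV"
    using sets_eq_imp_space_eq[OF sm] sets_eq_imp_space_eq[OF \<rho>] by simp_all
  have fst_m [measurable]: "fst \<in> \<rho> \<rightarrow>\<^sub>M borel" by measurable
  interpret m: prob_space m unfolding m_def by (rule \<rho>.prob_space_distr) simp
  have rect [measurable]: "B \<times> {..q} \<in> sets \<rho>" if "B \<in> sets borel" for B :: "'b set" and q
  proof -
    have "B \<times> {..q} = {w \<in> space \<rho>. fst w \<in> B \<and> snd w \<le> q}" by auto
    also have "\<dots> \<in> sets \<rho>" using that by measurable
    finally show ?thesis .
  qed
  define I where "I x = {q \<in> \<rat>. x < q}" for x :: real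
  define F where "F y x = (INF q\<in>I x. g q y)" for y x
  have I: "I x \<noteq> {}" "countable (I x)" for x
    using Rats_dense_in_real[of x "x + 1"] unfolding I_def
    by (auto intro: countable_subset[OF _ countable_rat])
  have bdd: "bdd_below ((\<lambda>q. g q y) ` A)" for y A using g01(1) by (auto intro!: bdd_belowI[of _ 0])
  have F_le: "F y x \<le> g q y" if "q \<in> I x" for y x q
    unfolding F_def by (rule cINF_lower[OF bdd that])
  have F_ge: "c \<le> F y x" if "\<And>q. q \<in> I x \<Longrightarrow> c \<le> g q y" for c y x
    unfolding F_def by (rule cINF_greatest[OF I(1) that])
  have [measurable]: "(\<lambda>y. F y x) \<in> borel_measurable borel" for x
    unfolding F_def by (rule borel_measurable_cINF) (auto intro: I bdd)
  have F0: "0 \<le> F y x" for y x by (rule F_ge) (rule g01)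
  have mono: "F y x \<le> F y x'" if "x \<le> x'" for y x x'
    using that by (intro F_ge F_le) (auto simp: I_def)
  have right: "continuous (at_right x) (F y)" for y x
    unfolding continuous_within
  proof (rule order_tendstoI)
    show "eventually (\<lambda>x'. c < F y x') (at_right x)" if "c < F y x" for c
    proof (rule eventually_at_rightI[of x "x + 1"])
      show "c < F y x'" if "x' \<in> {x<..<x + 1}" for x'
        using mono[of x x' y] \<open>c < F y x\<close> that by simp
    qed simp
    show "eventually (\<lambda>x'. F y x' < c) (at_right x)" if "F y x < c" for c
    proof -
      obtain q where q: "q \<in> I x" "g q y < c"
        using \<open>F y x < c\<close> unfolding F_def cINF_less_iff[OF I(1) bdd] by blast
      have "F y x' < c" if "x' \<in> {x<..<q}" for x'
        using F_le[of q x' y] that q by (auto simp: I_def)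
      then show ?thesis by (rule eventually_at_rightI) (use q in \<open>auto simp: I_def\<close>)
    qed
  qed
  have bot: "(F y \<longlongrightarrow> 0) at_bot" for y
  proof (rule tendsto_eventually)
    have "F y x = 0" if neg: "x < 0" for x
    proof -
      obtain q where "q \<in> \<rat>" "x < q" "q < 0" using Rats_dense_in_real[OF neg] by auto
      then show ?thesis using F_le[of q x y] F0[of y x] g01(3)[of q y] by (auto simp: I_def)
    qed
    then show "eventually (\<lambda>x. F y x = 0) at_bot"
      unfolding eventually_at_bot_dense by blast
  qed
  have top: "(F y \<longlongrightarrow> 1) at_top" for y
  proof (rule tendsto_eventually)
    have "F y x = 1" if "1 < x" for x
    proof (rule antisym)
      obtain q where "q \<in> I x" using I(1)[of x] by blast
      then show "F y x \<le> 1" using F_le[of q x y] g01(2)[of q y] by linarith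
      show "1 \<le> F y x" using g01(4)[of _ y] that by (intro F_ge) (auto simp: I_def)
    qed
    then show "eventually (\<lambda>x. F y x = 1) at_top"
      unfolding eventually_at_top_dense by blast
  qed
  define \<kappa> where "\<kappa> y = interval_measure (F y)" for y
  have \<kappa>_atMost: "emeasure (\<kappa> y) {..x} = ennreal (F y x)" for y x
    unfolding \<kappa>_def by (rule emeasure_interval_measure_Iic[OF mono right bot])
  have \<kappa>: "\<kappa> \<in> borel \<rightarrow>\<^sub>M prob_algebra borel"
  proof (rule measurable_prob_algebra_generated[where \<Omega> = UNIV and G = "range atMost"])
    show "sets (borel :: real measure) = sigma_sets UNIV (range atMost)"
      by (subst borel_eq_atMost) simp
    show "Int_stable (range (atMost :: real \<Rightarrow> _))"
      by (auto simp: Int_stable_def)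
    show "prob_space (\<kappa> y)" for y
      using real_distribution_interval_measure[OF mono right bot top, of y]
      by (simp add: \<kappa>_def real_distribution_def)
    show "(\<lambda>y. emeasure (\<kappa> y) A) \<in> borel_measurable borel" if "A \<in> range atMost" for A
      using that by (auto simp: \<kappa>_atMost)
  qed (auto simp: \<kappa>_def)
  have int_F: "(\<integral>\<^sup>+y\<in>B. ennreal (F y x) \<partial>m) = emeasure \<rho> (B \<times> {..x})"
    if B [measurable]: "B \<in> sets borel" for B x
  proof (rule antisym)
    have le: "(\<integral>\<^sup>+y\<in>B. ennreal (F y x) \<partial>m) \<le> emeasure \<rho> (B \<times> {..x'})" if less: "x < x'" for x'
    proof -
      obtain q where q: "q \<in> \<rat>" "x < q" "q < x'" using Rats_dense_in_real[OF less] by auto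
      have "(\<integral>\<^sup>+y\<in>B. ennreal (F y x) \<partial>m) \<le> (\<integral>\<^sup>+y\<in>B. ennreal (g q y) \<partial>m)"
        using q by (intro nn_integral_mono mult_right_mono ennreal_leI F_le) (auto simp: I_def)
      also have "\<dots> = emeasure \<rho> (B \<times> {..q})" unfolding m_def by (rule gint) fact
      also have "\<dots> \<le> emeasure \<rho> (B \<times> {..x'})" using q by (intro emeasure_mono) auto
      finally show ?thesis .
    qed
    let ?E = "\<lambda>n. B \<times> {..x + inverse (real (Suc n))}"
    have "(\<lambda>n. emeasure \<rho> (?E n)) \<longlonglongrightarrow> emeasure \<rho> (\<Inter>n. ?E n)"
    proof (rule Lim_emeasure_decseq)
      show "decseq ?E" by (auto simp: decseq_def elim!: order.trans intro!: le_imp_inverse_le)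
    qed auto
    also have "(\<Inter>n. ?E n) = B \<times> {..x}"
    proof -
      have "r \<le> x" if "\<And>n. r \<le> x + inverse (real (Suc n))" for r
      proof (rule LIMSEQ_le_const)
        show "(\<lambda>n. x + inverse (real (Suc n))) \<longlonglongrightarrow> x"
          using tendsto_add[OF tendsto_const LIMSEQ_inverse_real_of_nat] by fastforce
      qed (use that in auto)
      moreover have "r \<le> x + inverse (real (Suc n))" if "r \<le> x" for r n
        using that by (simp add: add_increasing2)
      ultimately show ?thesis by auto
    qed
    finally show "(\<integral>\<^sup>+y\<in>B. ennreal (F y x) \<partial>m) \<le> emeasure \<rho> (B \<times> {..x})"
      by (rule LIMSEQ_le_const) (auto intro!: le)
    have "AE y in m. ennreal (g x y) \<le> ennreal (g q y)" if "x < q" for q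
    proof (rule AE_le_of_nn_integral_le)
      have "(\<integral>\<^sup>+y. ennreal (g x y) \<partial>m) \<le> (\<integral>\<^sup>+y. 1 \<partial>m)"
        using g01(2) by (intro nn_integral_mono) (auto simp: ennreal_le_1)
      then show "(\<integral>\<^sup>+y. ennreal (g x y) \<partial>m) < \<infinity>"
        using m.emeasure_space_1 by (auto simp: less_top[symmetric] top_unique)
      show "(\<integral>\<^sup>+y\<in>A. ennreal (g x y) \<partial>m) \<le> (\<integral>\<^sup>+y\<in>A. ennreal (g q y) \<partial>m)" if "A \<in> sets m" for A
        using that \<open>x < q\<close> unfolding m_def by (simp add: gint emeasure_mono Sigma_mono)
    qed measurable
    then have "AE y in m. \<forall>q\<in>I x. g x y \<le> g q y"
      using g01(1) by (subst AE_ball_countable[OF I(2)]) (auto simp: I_def)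
    then have "AE y in m. g x y \<le> F y x"
      by eventually_elim (auto intro: F_ge)
    then have "(\<integral>\<^sup>+y\<in>B. ennreal (g x y) \<partial>m) \<le> (\<integral>\<^sup>+y\<in>B. ennreal (F y x) \<partial>m)"
      by (intro nn_integral_mono_AE) (auto elim!: eventually_mono intro!: mult_right_mono ennreal_leI)
    then show "emeasure \<rho> (B \<times> {..x}) \<le> (\<integral>\<^sup>+y\<in>B. ennreal (F y x) \<partial>m)"
      unfolding m_def by (simp add: gint)
  qed
  have K: "(\<lambda>y. distr (\<kappa> y) borel (Pair y)) \<in> borel \<rightarrow>\<^sub>M prob_algebra borel"
    by (rule measurable_distr_prob_space2[OF \<kappa>]) (simp add: borel_prod[symmetric])
  have m_in: "m \<in> space (prob_algebra borel)" by (simp add: space_prob_algebra m.prob_space_axioms)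
  have "\<rho> = m \<bind> (\<lambda>y. distr (\<kappa> y) borel (Pair y))" (is "_ = ?R")
  proof -
    have sR: "sets ?R = sets borel" by (rule sets_bind'[OF m_in K])
    let ?E = "{a \<times> b | a b. a \<in> sets (borel :: 'b measure) \<and> b \<in> range (atMost :: real \<Rightarrow> _)}"
    have *: "sets (borel :: ('b \<times> real) measure) = sigma_sets UNIV ?E"
    proof -
      have "sets (borel \<Otimes>\<^sub>M borel :: ('b \<times> real) measure) = sets (sigma (space borel \<times> space borel) ?E)"
      proof (rule sets_pair_eq[where Ca = "{UNIV}" and Cb = "range (\<lambda>n. {..real n})"])
        show "sets (borel :: real measure) = sigma_sets (space borel) (range atMost)"
          by (subst borel_eq_atMost) simp
        show "\<Union> (range (\<lambda>n. {..real n})) = space borel"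
          by (auto simp: real_arch_simple)
      qed (auto simp: sets.sigma_sets_eq[of borel, simplified] sets.sets_into_space)
      then show ?thesis unfolding borel_prod by (simp add: sets_measure_of_conv)
    qed
    show ?thesis
    proof (rule measure_eqI_generator_eq[where E = ?E and A = "\<lambda>n. UNIV \<times> {..real n}" and \<Omega> = UNIV])
      show "Int_stable ?E"
      proof (rule Int_stableI, clarsimp)
        fix a :: "'b set" and x :: real and a' :: "'b set" and x' :: real
        assume "a \<in> sets borel" "a' \<in> sets borel"
        then show "\<exists>b c. a \<times> {..x} \<inter> a' \<times> {..x'} = b \<times> c \<and> b \<in> sets borel \<and> c \<in> range atMost"
          by (intro exI[of _ "a \<inter> a'"] exI[of _ "{..min x x'}"]) auto
      qed
      show "(\<Union>n. UNIV \<times> {..real n}) = (UNIV :: ('b \<times> real) set)"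
        by (auto simp: real_arch_simple)
      show "range (\<lambda>n. UNIV \<times> {..real n}) \<subseteq> ?E"
      proof (rule image_subsetI)
        show "UNIV \<times> {..real n} \<in> ?E" for n
          by (rule CollectI, rule exI[of _ UNIV], rule exI[of _ "{..real n}"]) simp
      qed
      fix X assume "X \<in> ?E"
      then obtain B x where X: "X = B \<times> {..x}" and B [measurable]: "B \<in> sets borel" by auto
      have X_sets: "X \<in> sets borel" using rect[OF B, of x] X \<rho> by simp
      have "emeasure ?R X = (\<integral>\<^sup>+y. emeasure (distr (\<kappa> y) borel (Pair y)) X \<partial>m)"
        by (rule emeasure_bind_prob_algebra[OF m_in K X_sets])
      also have "\<dots> = (\<integral>\<^sup>+y\<in>B. ennreal (F y x) \<partial>m)"
      proof (rule nn_integral_cong)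
        fix y
        have "emeasure (distr (\<kappa> y) borel (Pair y)) X = emeasure (\<kappa> y) (Pair y -` X)"
          using X_sets by (subst emeasure_distr) (auto simp: \<kappa>_def)
        also have "Pair y -` X = (if y \<in> B then {..x} else {})" by (auto simp: X)
        finally show "emeasure (distr (\<kappa> y) borel (Pair y)) X = ennreal (F y x) * indicator B y"
          by (simp add: \<kappa>_atMost)
      qed
      also have "\<dots> = emeasure \<rho> X" unfolding X by (rule int_F) fact
      finally show "emeasure \<rho> X = emeasure ?R X" ..
    qed (auto simp: * sR \<rho> \<rho>.emeasure_eq_measure)
  qed
  with \<kappa> show ?thesis unfolding disintegration_def m_def by blast
qed

text \<open>
  The second factor is coded by reals in the unit interval, disintegrated there, and the resulting
  kernel is pushed forward along the decoding.
\<close>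

proposition disintegration_exists:
  fixes \<nu> :: "('b::polish_space \<times> 'c::polish_space) measure"
  assumes \<nu>: "sets \<nu> = sets borel" and "prob_space \<nu>"
  shows "\<exists>\<kappa>. disintegration \<nu> \<kappa>"
proof -
  interpret prob_space \<nu> by fact
  note [measurable_cong] = \<nu>
  obtain \<phi> :: "'c \<Rightarrow> real" and \<psi> where
    [measurable]: "\<phi> \<in> borel_measurable borel" "\<psi> \<in> borel_measurable borel" and
    inv: "\<And>z. \<psi> (\<phi> z) = z" and bounds: "\<And>z. 0 \<le> \<phi> z" "\<And>z. \<phi> z < 1"
    by (rule real_coding) blast
  define \<rho> where "\<rho> = distr \<nu> borel (\<lambda>w. (fst w, \<phi> (snd w)))"
  have "prob_space \<rho>" unfolding \<rho>_def by (rule prob_space_distr) measurable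
  moreover have "AE w in \<rho>. 0 \<le> snd w \<and> snd w < 1"
    unfolding \<rho>_def by (subst AE_distr_iff) (auto simp: bounds)
  moreover have "sets \<rho> = sets borel" by (simp add: \<rho>_def)
  ultimately obtain \<kappa> where \<kappa>: "\<kappa> \<in> borel \<rightarrow>\<^sub>M prob_algebra borel"
    and dis: "\<rho> = distr \<rho> borel fst \<bind> (\<lambda>y. distr (\<kappa> y) borel (Pair y))"
    using real_disintegration[of \<rho>] unfolding disintegration_def by blast
  have m: "distr \<rho> borel fst = distr \<nu> borel fst"
    unfolding \<rho>_def by (subst distr_distr) (auto simp: comp_def)
  have K: "(\<lambda>y. distr (\<kappa> y) borel (Pair y)) \<in> borel \<rightarrow>\<^sub>M prob_algebra borel"
    by (rule measurable_distr_prob_space2[OF \<kappa>]) (simp add: borel_prod[symmetric])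
  have s\<kappa>: "sets (\<kappa> y) = sets borel" for y
    using measurable_space[OF \<kappa>, of y] by (simp add: space_prob_algebra)
  let ?\<kappa> = "\<lambda>y. distr (\<kappa> y) borel \<psi>"
  have "?\<kappa> \<in> borel \<rightarrow>\<^sub>M prob_algebra borel"
    by (rule measurable_compose[OF \<kappa> measurable_distr_prob_space]) measurable
  moreover have "\<nu> = distr \<nu> borel fst \<bind> (\<lambda>y. distr (?\<kappa> y) borel (Pair y))"
  proof -
    have "\<nu> = distr \<rho> borel (\<lambda>w. (fst w, \<psi> (snd w)))"
      unfolding \<rho>_def by (subst distr_distr) (simp_all add: comp_def inv distr_id2[OF \<nu>[symmetric]])
    also have "\<dots> = distr \<nu> borel fst \<bind>
        (\<lambda>y. distr (distr (\<kappa> y) borel (Pair y)) borel (\<lambda>w. (fst w, \<psi> (snd w))))"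
      by (subst dis, subst m, rule distr_bind[OF measurable_prob_algebraD]) (use K in auto)
    also have "\<dots> = distr \<nu> borel fst \<bind> (\<lambda>y. distr (?\<kappa> y) borel (Pair y))"
    proof (intro bind_cong refl)
      fix y
      note [measurable_cong] = s\<kappa>
      show "distr (distr (\<kappa> y) borel (Pair y)) borel (\<lambda>w. (fst w, \<psi> (snd w))) =
          distr (?\<kappa> y) borel (Pair y)"
        by (subst (1 2) distr_distr) (auto simp: comp_def)
    qed
    finally show ?thesis .
  qed
  ultimately show ?thesis unfolding disintegration_def by blast
qed

section \<open>Borel probability measures and conditionally independent products\<close>

text \<open>
  Membership in the space of the Giry monad is used as the form of "Borel probability measure", so
  that the library facts on probability kernels apply directly.
\<close>

abbreviation borel_probs :: "'a::topological_space measure set" where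
  "borel_probs \<equiv> space (prob_algebra borel)"

lemma borel_probs_iff: "\<mu> \<in> borel_probs \<longleftrightarrow> sets \<mu> = sets borel \<and> prob_space \<mu>"
  by (simp add: space_prob_algebra)

lemma borel_probs_sets: "\<mu> \<in> borel_probs \<Longrightarrow> sets \<mu> = sets borel"
  by (simp add: borel_probs_iff)

lemma borel_probs_space: "\<mu> \<in> borel_probs \<Longrightarrow> space \<mu> = UNIV"
  using sets_eq_imp_space_eq[of \<mu> borel] by (simp add: borel_probs_iff)

lemma borel_probs_prob_space: "\<mu> \<in> borel_probs \<Longrightarrow> prob_space \<mu>"
  by (simp add: borel_probs_iff)

lemma borel_probs_measurable:
  assumes "\<mu> \<in> borel_probs" "f \<in> borel \<rightarrow>\<^sub>M N"
  shows "f \<in> \<mu> \<rightarrow>\<^sub>M N"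
  using assms(2) unfolding measurable_cong_sets[OF borel_probs_sets[OF assms(1)] refl] .

lemma distr_borel_probs:
  assumes "\<mu> \<in> borel_probs" "f \<in> borel \<rightarrow>\<^sub>M borel"
  shows "distr \<mu> borel f \<in> borel_probs"
  unfolding borel_probs_iff
  using prob_space.prob_space_distr[OF borel_probs_prob_space[OF assms(1)] borel_probs_measurable[OF assms]]
  by simp

lemma distr_distr_borel:
  assumes "\<mu> \<in> borel_probs" "f \<in> borel \<rightarrow>\<^sub>M borel" "g \<in> borel \<rightarrow>\<^sub>M borel"
  shows "distr (distr \<mu> borel f) borel g = distr \<mu> borel (\<lambda>x. g (f x))"
  using distr_distr[OF assms(3) borel_probs_measurable[OF assms(1,2)]] by (simp add: comp_def)

lemma emeasure_distr_borel:
  assumes "\<mu> \<in> borel_probs" "f \<in> borel \<rightarrow>\<^sub>M borel" "A \<in> sets borel"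
  shows "emeasure (distr \<mu> borel f) A = emeasure \<mu> {x. f x \<in> A}"
  using emeasure_distr[OF borel_probs_measurable[OF assms(1,2)] assms(3)]
  by (simp add: borel_probs_space[OF assms(1)] vimage_def)

lemma nn_integral_distr_borel:
  assumes "\<mu> \<in> borel_probs" "f \<in> borel \<rightarrow>\<^sub>M borel" "g \<in> borel_measurable borel"
  shows "(\<integral>\<^sup>+y. g y \<partial>distr \<mu> borel f) = (\<integral>\<^sup>+x. g (f x) \<partial>\<mu>)"
  by (rule nn_integral_distr[OF borel_probs_measurable[OF assms(1,2)]]) (simp add: assms(3))

lemma AE_distr_borel:
  assumes "\<mu> \<in> borel_probs" "f \<in> borel \<rightarrow>\<^sub>M borel" "Measurable.pred borel P"
  shows "(AE y in distr \<mu> borel f. P y) \<longleftrightarrow> (AE x in \<mu>. P (f x))"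
  by (rule AE_distr_iff[OF borel_probs_measurable[OF assms(1,2)] assms(3)[unfolded pred_def]])

text \<open>
  This is the choice made inside \<open>ci_prod\<close>. It depends on the right factor only, so that different
  left factors are composed with literally the same kernel.
\<close>

definition kernel_of ::
  "('b::polish_space \<times> 'c::polish_space) measure \<Rightarrow> 'b \<Rightarrow> 'c measure" where
  "kernel_of \<nu> = (SOME \<kappa>. disintegration \<nu> \<kappa>)"

lemma disintegration_kernel_of: "\<nu> \<in> borel_probs \<Longrightarrow> disintegration \<nu> (kernel_of \<nu>)"
  unfolding kernel_of_def borel_probs_iff by (intro someI_ex[OF disintegration_exists]) auto

lemma
  assumes "\<nu> \<in> borel_probs"
  shows kernel_of_measurable: "kernel_of \<nu> \<in> borel \<rightarrow>\<^sub>M prob_algebra borel"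
    and bind_kernel_of: "distr \<nu> borel fst \<bind> (\<lambda>y. distr (kernel_of \<nu> y) borel (Pair y)) = \<nu>"
  using disintegration_kernel_of[OF assms, unfolded disintegration_def]
  by (rule conjunct1, rule conjunct2[THEN sym])

lemma kernel_of_borel_probs: "\<nu> \<in> borel_probs \<Longrightarrow> kernel_of \<nu> y \<in> borel_probs"
  using measurable_space[OF kernel_of_measurable, of \<nu> y] by simp

context
  fixes \<mu> :: "('a::polish_space \<times> 'b::polish_space) measure"
    and \<nu> :: "('b \<times> 'c::polish_space) measure"
  assumes \<mu>: "\<mu> \<in> borel_probs" and \<nu>: "\<nu> \<in> borel_probs"
begin

lemma ci_prod_eq_bind:
  "ci_prod \<mu> \<nu> = \<mu> \<bind> (\<lambda>w. distr (kernel_of \<nu> (snd w)) borel (\<lambda>z. (fst w, snd w, z)))"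
  by (simp add: ci_prod_def kernel_of_def case_prod_unfold)

lemma ci_kernel_measurable:
  "(\<lambda>w :: 'a \<times> 'b. distr (kernel_of \<nu> (snd w)) borel (\<lambda>z. (fst w, snd w, z)))
     \<in> borel \<rightarrow>\<^sub>M prob_algebra borel"
proof (rule measurable_distr_prob_space2)
  show "(\<lambda>w. kernel_of \<nu> (snd w)) \<in> borel \<rightarrow>\<^sub>M prob_algebra borel"
    by (rule measurable_compose[OF _ kernel_of_measurable[OF \<nu>]]) measurable
  show "(\<lambda>(w :: 'a \<times> 'b, z :: 'c). (fst w, snd w, z)) \<in> borel \<Otimes>\<^sub>M borel \<rightarrow>\<^sub>M borel"
    unfolding borel_prod case_prod_unfold
    by (intro borel_measurable_continuous_onI continuous_intros)
qed

lemma ci_prod_borel_probs: "ci_prod \<mu> \<nu> \<in> borel_probs"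
  unfolding ci_prod_eq_bind borel_probs_iff
  using sets_bind'[OF \<mu> ci_kernel_measurable] prob_space_bind'[OF \<mu> ci_kernel_measurable] by simp

lemma distr_ci_prod:
  assumes [measurable]: "f \<in> borel \<rightarrow>\<^sub>M borel"
  shows "distr (ci_prod \<mu> \<nu>) borel f =
    \<mu> \<bind> (\<lambda>w. distr (kernel_of \<nu> (snd w)) borel (\<lambda>z. f (fst w, snd w, z)))"
proof -
  have "distr (ci_prod \<mu> \<nu>) borel f =
      \<mu> \<bind> (\<lambda>w. distr (distr (kernel_of \<nu> (snd w)) borel (\<lambda>z. (fst w, snd w, z))) borel f)"
    unfolding ci_prod_eq_bind
    by (rule distr_bind[where K = borel])
       (auto intro!: borel_probs_measurable[OF \<mu>] measurable_prob_algebraD[OF ci_kernel_measurable]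
             simp: borel_probs_space[OF \<mu>])
  then show ?thesis
    by (simp add: distr_distr_borel[OF kernel_of_borel_probs[OF \<nu>]])
qed

lemma distr_ci_prod_left: "distr (ci_prod \<mu> \<nu>) borel (\<lambda>w. (fst w, fst (snd w))) = \<mu>"
proof -
  have "distr (kernel_of \<nu> (snd w)) borel (\<lambda>z. (fst w, fst (snd w, z))) = return borel w"
    for w :: "'a \<times> 'b"
    using prob_space.distr_const[OF borel_probs_prob_space[OF kernel_of_borel_probs[OF \<nu>]], of w borel]
    by simp
  then show ?thesis
    by (subst distr_ci_prod) (simp_all add: bind_return''[OF borel_probs_sets[OF \<mu>]])
qed

lemma bind_snd:
  assumes "N \<in> borel \<rightarrow>\<^sub>M prob_algebra borel"
  shows "\<mu> \<bind> (\<lambda>w. N (snd w)) = distr \<mu> borel snd \<bind> N"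
  by (rule bind_distr[symmetric, OF borel_probs_measurable[OF \<mu>] measurable_prob_algebraD[OF assms]])
     (simp_all add: borel_probs_space[OF \<mu>])

text \<open>
  Together with \<open>distr_ci_prod_left\<close> this is the gluing lemma: two measures
  with a common marginal are the marginals of one measure on the triple product. All
  gluings of couplings below are conditionally independent products.
\<close>

lemma distr_ci_prod_right:
  assumes "distr \<mu> borel snd = distr \<nu> borel fst"
  shows "distr (ci_prod \<mu> \<nu>) borel snd = \<nu>"
proof -
  have K: "(\<lambda>y. distr (kernel_of \<nu> y) borel (Pair y)) \<in> borel \<rightarrow>\<^sub>M prob_algebra borel"
    by (rule measurable_distr_prob_space2[OF kernel_of_measurable[OF \<nu>]]) (simp add: borel_prod[symmetric])
  have "distr (ci_prod \<mu> \<nu>) borel snd = \<mu> \<bind> (\<lambda>w. distr (kernel_of \<nu> (snd w)) borel (Pair (snd w)))"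
    by (subst distr_ci_prod) simp_all
  also have "\<dots> = distr \<nu> borel fst \<bind> (\<lambda>y. distr (kernel_of \<nu> y) borel (Pair y))"
    unfolding assms[symmetric] by (rule bind_snd[OF K])
  also have "\<dots> = \<nu>" by (rule bind_kernel_of[OF \<nu>])
  finally show ?thesis .
qed

end

lemma distr_ci_prod_map:
  fixes \<mu> :: "('a::polish_space \<times> 'b::polish_space) measure"
    and \<nu> :: "('b \<times> 'c::polish_space) measure" and g :: "'a \<Rightarrow> 'd::polish_space"
  assumes \<mu>: "\<mu> \<in> borel_probs" and \<nu>: "\<nu> \<in> borel_probs" and [measurable]: "g \<in> borel \<rightarrow>\<^sub>M borel"
  shows "distr (ci_prod \<mu> \<nu>) borel (\<lambda>w. (g (fst w), snd w)) =
    ci_prod (distr \<mu> borel (\<lambda>w. (g (fst w), snd w))) \<nu>"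
proof -
  let ?\<mu> = "distr \<mu> borel (\<lambda>w. (g (fst w), snd w))"
  have \<mu>': "?\<mu> \<in> borel_probs" by (rule distr_borel_probs[OF \<mu>]) measurable
  have "ci_prod ?\<mu> \<nu> = \<mu> \<bind> (\<lambda>w. distr (kernel_of \<nu> (snd w)) borel (\<lambda>z. (g (fst w), snd w, z)))"
    unfolding ci_prod_eq_bind[OF \<mu>' \<nu>]
    by (subst bind_distr[OF borel_probs_measurable[OF \<mu>] measurable_prob_algebraD[OF ci_kernel_measurable[OF \<mu>' \<nu>]]])
       (simp_all add: borel_probs_space[OF \<mu>])
  moreover have "distr (ci_prod \<mu> \<nu>) borel (\<lambda>w. (g (fst w), snd w)) =
      \<mu> \<bind> (\<lambda>w. distr (kernel_of \<nu> (snd w)) borel (\<lambda>z. (g (fst w), snd w, z)))"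
    by (subst distr_ci_prod[OF \<mu> \<nu>]) simp_all
  ultimately show ?thesis by simp
qed

lemma couplings_iff:
  "\<gamma> \<in> couplings \<mu> \<nu> \<longleftrightarrow> \<gamma> \<in> borel_probs \<and> distr \<gamma> borel fst = \<mu> \<and> distr \<gamma> borel snd = \<nu>"
  by (simp add: couplings_def borel_probs_iff)

lemma product_coupling:
  fixes \<mu> \<nu> :: "'a::polish_space measure"
  assumes "\<mu> \<in> borel_probs" "\<nu> \<in> borel_probs"
  shows "\<mu> \<Otimes>\<^sub>M \<nu> \<in> couplings \<mu> \<nu>"
proof -
  interpret \<mu>: prob_space \<mu> using assms(1) by (rule borel_probs_prob_space)
  interpret \<nu>: prob_space \<nu> using assms(2) by (rule borel_probs_prob_space)
  interpret pair_prob_space \<mu> \<nu> ..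
  have s: "sets (\<mu> \<Otimes>\<^sub>M \<nu>) = sets borel"
    using sets_pair_measure_cong[OF borel_probs_sets[OF assms(1)] borel_probs_sets[OF assms(2)]]
    unfolding borel_prod .
  have "distr (\<mu> \<Otimes>\<^sub>M \<nu>) borel fst = distr (\<mu> \<Otimes>\<^sub>M \<nu>) \<mu> fst"
    by (rule distr_cong) (auto simp: borel_probs_sets[OF assms(1)])
  moreover have "distr (\<mu> \<Otimes>\<^sub>M \<nu>) borel snd = \<nu>"
  proof (rule measure_eqI)
    fix A assume "A \<in> sets (distr (\<mu> \<Otimes>\<^sub>M \<nu>) borel snd)"
    then have A: "A \<in> sets \<nu>" by (simp add: borel_probs_sets[OF assms(2)])
    have "snd \<in> \<mu> \<Otimes>\<^sub>M \<nu> \<rightarrow>\<^sub>M borel"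
      unfolding measurable_cong_sets[OF refl borel_probs_sets[OF assms(2), symmetric]]
      by (rule measurable_snd)
    then have "emeasure (distr (\<mu> \<Otimes>\<^sub>M \<nu>) borel snd) A = emeasure (\<mu> \<Otimes>\<^sub>M \<nu>) (snd -` A \<inter> space (\<mu> \<Otimes>\<^sub>M \<nu>))"
      using A by (intro emeasure_distr) (auto simp: borel_probs_sets[OF assms(2)])
    also have "snd -` A \<inter> space (\<mu> \<Otimes>\<^sub>M \<nu>) = space \<mu> \<times> A"
      using sets.sets_into_space[OF A] by (auto simp: space_pair_measure)
    also have "emeasure (\<mu> \<Otimes>\<^sub>M \<nu>) (space \<mu> \<times> A) = emeasure \<nu> A"
      using A by (simp add: \<nu>.emeasure_pair_measure_Times \<mu>.emeasure_space_1)
    finally show "emeasure (distr (\<mu> \<Otimes>\<^sub>M \<nu>) borel snd) A = emeasure \<nu> A" .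
  qed (simp add: borel_probs_sets[OF assms(2)])
  ultimately show ?thesis
    using \<nu>.distr_pair_fst[of \<mu>] s by (simp add: couplings_iff borel_probs_iff prob_space_axioms)
qed

section \<open>Minkowski's inequality\<close>

text \<open>
  Convexity of the power function applied to \<open>(a + b) / (A + B)\<close>, which is a convex combination of
  \<open>a / A\<close> and \<open>b / B\<close>. It yields Minkowski's inequality for integrals and for pairs alike when \<open>A\<close>
  and \<open>B\<close> bound the two norms.
\<close>

lemma powr_add_le_convex:
  fixes a b A B p :: real
  assumes "1 \<le> p" "0 \<le> a" "0 \<le> b" "0 < A" "0 < B"
  shows "(a + b) powr p \<le> (A + B) powr (p - 1) * (A powr (1 - p) * a powr p + B powr (1 - p) * b powr p)"
proof -
  have mono: "c powr p \<le> (A + B) powr (p - 1) * (C powr (1 - p) * c powr p)"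
    if "0 < C" "C \<le> A + B" for C c
  proof -
    have "1 = C powr (p - 1) * C powr (1 - p)" 
      using that by (subst powr_add[symmetric]) simp
    also have "\<dots> \<le> (A + B) powr (p - 1) * C powr (1 - p)"
      using that assms by (intro mult_right_mono powr_mono2) auto
    finally have "1 * c powr p \<le> (A + B) powr (p - 1) * C powr (1 - p) * c powr p"
      by (intro mult_right_mono) auto
    then show ?thesis by (simp add: mult.assoc)
  qed
  consider "a = 0" | "b = 0" | "0 < a" "0 < b" using assms by linarith
  then show ?thesis
  proof cases
    case 1 then show ?thesis using mono[of B b] assms by simp
  next
    case 2 then show ?thesis using mono[of A a] assms by simp
  next
    case 3
    define t where "t = B / (A + B)"
    have t: "0 \<le> t" "t \<le> 1" "1 - t = A / (A + B)" using assms by (auto simp: t_def field_simps)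
    have "((1 - t) *\<^sub>R (a / A) + t *\<^sub>R (b / B)) powr p \<le> (1 - t) * (a / A) powr p + t * (b / B) powr p"
      using 3 assms t by (intro convex_onD[OF powr_convex]) auto
    also have "(1 - t) *\<^sub>R (a / A) + t *\<^sub>R (b / B) = (a + b) / (A + B)"
      unfolding t(3) using assms by (simp add: t_def add_divide_distrib)
    finally have "((a + b) / (A + B)) powr p \<le> A / (A + B) * (a / A) powr p + B / (A + B) * (b / B) powr p"
      unfolding t(3) by (simp add: t_def)
    then have "(A + B) powr p * ((a + b) / (A + B)) powr p \<le>
        (A + B) powr p * (A / (A + B) * (a / A) powr p + B / (A + B) * (b / B) powr p)"
      by (intro mult_left_mono) auto
    also have "(A + B) powr p * ((a + b) / (A + B)) powr p = (a + b) powr p"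
      using assms by (simp add: powr_divide)
    also have "(A + B) powr p * (A / (A + B) * (a / A) powr p + B / (A + B) * (b / B) powr p) =
        (A + B) powr (p - 1) * (A powr (1 - p) * a powr p + B powr (1 - p) * b powr p)"
    proof -
      have "(A + B) powr p * (C / (A + B) * (c / C) powr p) = (A + B) powr (p - 1) * (C powr (1 - p) * c powr p)"
        if "0 < C" "0 < c" for C c
        using that assms by (simp add: powr_divide powr_diff)
      then show ?thesis using 3 assms by (simp add: distrib_left)
    qed
    finally show ?thesis .
  qed
qed

text \<open>
  Cruder than the convexity bound, but free of the parameters \<open>A\<close> and \<open>B\<close>; it serves wherever only
  smallness or finiteness of a cost matters.
\<close>

lemma powr_add_le_double:
  fixes a b p :: real
  assumes "0 \<le> p" "0 \<le> a" "0 \<le> b"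
  shows "(a + b) powr p \<le> 2 powr p * (a powr p + b powr p)"
proof -
  have "(a + b) powr p \<le> (2 * max a b) powr p" using assms by (intro powr_mono2) auto
  also have "\<dots> = 2 powr p * max a b powr p" using assms by (simp add: powr_mult)
  also have "max a b powr p \<le> a powr p + b powr p" by (auto simp: max_def)
  finally show ?thesis by simp
qed

lemma nn_integral_Minkowski:
  fixes p A B :: real
  assumes "1 \<le> p" "0 < A" "0 < B"
    and [measurable]: "f \<in> borel_measurable M" "g \<in> borel_measurable M"
    and nn: "\<And>x. 0 \<le> f x" "\<And>x. 0 \<le> g x"
    and f: "(\<integral>\<^sup>+x. ennreal (f x powr p) \<partial>M) \<le> ennreal (A powr p)"
    and g: "(\<integral>\<^sup>+x. ennreal (g x powr p) \<partial>M) \<le> ennreal (B powr p)"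
  shows "(\<integral>\<^sup>+x. ennreal ((f x + g x) powr p) \<partial>M) \<le> ennreal ((A + B) powr p)"
proof -
  let ?c = "(A + B) powr (p - 1)"
  have "(\<integral>\<^sup>+x. ennreal ((f x + g x) powr p) \<partial>M) \<le>
      (\<integral>\<^sup>+x. ennreal ?c * (ennreal (A powr (1 - p)) * ennreal (f x powr p) +
                    ennreal (B powr (1 - p)) * ennreal (g x powr p)) \<partial>M)"
    using powr_add_le_convex[OF assms(1) nn assms(2,3)]
    by (intro nn_integral_mono) (simp add: ennreal_mult'[symmetric] ennreal_plus[symmetric] ennreal_leI del: ennreal_plus)
  also have "\<dots> = ennreal ?c * (ennreal (A powr (1 - p)) * (\<integral>\<^sup>+x. ennreal (f x powr p) \<partial>M) +
                    ennreal (B powr (1 - p)) * (\<integral>\<^sup>+x. ennreal (g x powr p) \<partial>M))"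
    by (simp add: nn_integral_cmult nn_integral_add)
  also have "\<dots> \<le> ennreal ?c * (ennreal (A powr (1 - p)) * ennreal (A powr p) +
                    ennreal (B powr (1 - p)) * ennreal (B powr p))"
    by (intro mult_left_mono add_mono f g) auto
  also have "\<dots> = ennreal (?c * (A powr (1 - p) * A powr p + B powr (1 - p) * B powr p))"
    by (simp add: ennreal_mult'[symmetric] ennreal_plus[symmetric] del: ennreal_plus)
  also have "?c * (A powr (1 - p) * A powr p + B powr (1 - p) * B powr p) = (A + B) powr p"
    using assms by (simp add: powr_add[symmetric] powr_diff)
  finally show ?thesis .
qed

section \<open>Wasserstein distances of compatible metrics\<close>

text \<open>
  A metric that induces the topology of the type. The last two assumptions are the two inclusions
  between the topologies: \<open>d_continuous\<close> makes \<open>d\<close>-balls open, and \<open>d_nhd\<close> places a \<open>d\<close>-ball inside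
  every open neighbourhood.
\<close>

locale compatible_metric =
  fixes d :: "'a::polish_space \<Rightarrow> 'a \<Rightarrow> real"
  assumes d_nonneg: "0 \<le> d x y"
    and d_zero: "d x y = 0 \<longleftrightarrow> x = y"
    and d_commute: "d x y = d y x"
    and d_triangle: "d x z \<le> d x y + d y z"
    and d_continuous: "continuous_on UNIV (\<lambda>w. d (fst w) (snd w))"
    and d_nhd: "open U \<Longrightarrow> x \<in> U \<Longrightarrow> \<exists>r>0. \<forall>y. d x y < r \<longrightarrow> y \<in> U"

definition transport_cost ::
  "real \<Rightarrow> ('a::topological_space \<Rightarrow> 'a \<Rightarrow> real) \<Rightarrow> ('a \<times> 'a) measure \<Rightarrow> ennreal" where
  "transport_cost p d \<gamma> = (\<integral>\<^sup>+w. ennreal (d (fst w) (snd w) powr p) \<partial>\<gamma>)"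

lemma Wp_transport_cost:
  "Wp p d \<mu> \<nu> = enn2real (INF \<gamma>\<in>couplings \<mu> \<nu>. transport_cost p d \<gamma>) powr (1 / p)"
  by (simp add: Wp_def transport_cost_def case_prod_unfold)

context compatible_metric
begin

lemma d_self [simp]: "d x x = 0"
  by (simp add: d_zero)

lemma borel_measurable_d [measurable (raw)]:
  assumes [measurable]: "f \<in> borel_measurable M" "g \<in> borel_measurable M"
  shows "(\<lambda>x. d (f x) (g x)) \<in> borel_measurable M"
  using measurable_compose[OF borel_measurable_Pair[OF assms] borel_measurable_continuous_onI[OF d_continuous]]
  by simp

lemma open_d_ball: "open {y. d x y < r}"
proof (rule open_Collect_less)
  show "continuous_on UNIV (\<lambda>y. d x y)"
    using continuous_on_compose2[OF d_continuous, of UNIV "Pair x"] by (simp add: continuous_on_Pair)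
qed (rule continuous_on_const)

text \<open>
  Every point of \<open>K\<close> has a \<open>d\<close>-ball inside \<open>U\<close>. Finitely many of these balls, shrunk to half their
  radius, cover \<open>K\<close>, and the least of the half radii is a margin by the triangle inequality.
\<close>

lemma compact_subset_open_margin:
  assumes "compact K" "open U" "K \<subseteq> U"
  obtains r where "0 < r" "\<And>x y. x \<in> K \<Longrightarrow> d x y < r \<Longrightarrow> y \<in> U"
proof -
  have "\<forall>x\<in>K. \<exists>r>0. \<forall>y. d x y < r \<longrightarrow> y \<in> U"
    using d_nhd[OF assms(2)] assms(3) by blast
  then obtain r where r: "\<And>x. x \<in> K \<Longrightarrow> 0 < r x" "\<And>x y. x \<in> K \<Longrightarrow> d x y < r x \<Longrightarrow> y \<in> U"
    by (metis (no_types) bchoice)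
  have "K \<subseteq> (\<Union>x\<in>K. {y. d x y < r x / 2})"
  proof
    fix x assume "x \<in> K"
    moreover have "d x x < r x / 2" using r(1)[OF \<open>x \<in> K\<close>] by simp
    ultimately show "x \<in> (\<Union>x\<in>K. {y. d x y < r x / 2})" by blast
  qed
  from compactE_image[OF assms(1) open_d_ball this]
  obtain C where C: "C \<subseteq> K" "finite C" "K \<subseteq> (\<Union>x\<in>C. {y. d x y < r x / 2})" .
  define s where "s = Min (insert 1 ((\<lambda>x. r x / 2) ` C))"
  have s: "s \<le> r x / 2" if "x \<in> C" for x
    unfolding s_def using C(2) that by (intro Min_le) auto
  have "0 < s" unfolding s_def using C(1,2) r(1) by (subst Min_gr_iff) auto
  moreover have "y \<in> U" if "x \<in> K" "d x y < s" for x y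
  proof -
    obtain c where c: "c \<in> C" "d c x < r c / 2" using C(3) \<open>x \<in> K\<close> by blast
    have "d c y < r c" using d_triangle[of c y x] c s[OF c(1)] that by linarith
    then show ?thesis using r(2)[of c y] c(1) C(1) by blast
  qed
  ultimately show thesis by (rule that)
qed

text \<open>
  Markov's inequality for the transport cost.
\<close>

lemma far_apart_emeasure_le:
  assumes \<gamma>: "\<gamma> \<in> borel_probs" and "0 < r" "0 < p" "0 \<le> e"
    and cost: "transport_cost p d \<gamma> \<le> ennreal (r powr p * e)"
  shows "emeasure \<gamma> {w. r \<le> d (fst w) (snd w)} \<le> ennreal e"
proof -
  note [measurable_cong] = borel_probs_sets[OF \<gamma>]
  let ?A = "{w \<in> space \<gamma>. r \<le> d (fst w) (snd w)}"
  have "ennreal (r powr p) * emeasure \<gamma> ?A = (\<integral>\<^sup>+w. ennreal (r powr p) * indicator ?A w \<partial>\<gamma>)"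
    by (rule nn_integral_cmult_indicator[symmetric]) measurable
  also have "\<dots> \<le> transport_cost p d \<gamma>"
    unfolding transport_cost_def using assms(2,3)
    by (intro nn_integral_mono) (auto simp: indicator_def intro!: ennreal_leI powr_mono2)
  also have "\<dots> \<le> ennreal (r powr p) * ennreal e"
    using cost assms by (simp add: ennreal_mult)
  finally show ?thesis
    using assms(2) by (simp add: borel_probs_space[OF \<gamma>] ennreal_mult_le_mult_iff)
qed

lemma quasi_triangle:
  assumes "0 \<le> p"
  shows "d x z powr p \<le> 2 powr p * (d x y powr p + d y z powr p)"
  using powr_mono2[OF assms d_nonneg d_triangle[of x z y]] powr_add_le_double[OF assms d_nonneg d_nonneg]
  by (rule order.trans)

end

locale wasserstein = compatible_metric d for d :: "'a::polish_space \<Rightarrow> 'a \<Rightarrow> real" +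
  fixes p :: real
  assumes p_ge_1: "1 \<le> p"
begin

lemma Pp_borel_probs: "\<mu> \<in> Pp p d \<Longrightarrow> \<mu> \<in> borel_probs"
  by (simp add: Pp_def borel_probs_iff)

lemma moment_finite:
  assumes \<mu>: "\<mu> \<in> Pp p d"
  shows "(\<integral>\<^sup>+x. ennreal (d a x powr p) \<partial>\<mu>) < \<infinity>"
proof -
  note [measurable_cong] = borel_probs_sets[OF Pp_borel_probs[OF \<mu>]]
  interpret prob_space \<mu> using Pp_borel_probs[OF \<mu>] by (rule borel_probs_prob_space)
  obtain x0 where x0: "(\<integral>\<^sup>+x. ennreal (d x0 x powr p) \<partial>\<mu>) < \<infinity>"
    using \<mu> by (auto simp: Pp_def)
  have "(\<integral>\<^sup>+x. ennreal (d a x powr p) \<partial>\<mu>) \<le>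
      (\<integral>\<^sup>+x. ennreal (2 powr p) * (ennreal (d a x0 powr p) + ennreal (d x0 x powr p)) \<partial>\<mu>)"
    using quasi_triangle[of p a _ x0] p_ge_1
    by (intro nn_integral_mono) (simp add: ennreal_mult[symmetric] ennreal_plus[symmetric] ennreal_leI del: ennreal_plus)
  also have "\<dots> = ennreal (2 powr p) * (ennreal (d a x0 powr p) + (\<integral>\<^sup>+x. ennreal (d x0 x powr p) \<partial>\<mu>))"
    by (simp add: nn_integral_cmult nn_integral_add emeasure_space_1)
  also have "\<dots> < \<infinity>" using x0 by (simp add: ennreal_mult_less_top)
  finally show ?thesis .
qed

lemma coupling_cost_finite:
  assumes \<mu>: "\<mu> \<in> Pp p d" and \<nu>: "\<nu> \<in> Pp p d" and \<gamma>: "\<gamma> \<in> couplings \<mu> \<nu>"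
  shows "transport_cost p d \<gamma> < \<infinity>"
proof -
  have \<gamma>': "\<gamma> \<in> borel_probs" using \<gamma> by (simp add: couplings_iff)
  note [measurable_cong] = borel_probs_sets[OF \<gamma>']
  define a :: 'a where "a = undefined"
  have "transport_cost p d \<gamma> \<le> (\<integral>\<^sup>+w. ennreal (2 powr p) *
      (ennreal (d a (fst w) powr p) + ennreal (d a (snd w) powr p)) \<partial>\<gamma>)"
    unfolding transport_cost_def using quasi_triangle[of p _ _ a] p_ge_1 d_commute[of _ a]
    by (intro nn_integral_mono) (simp add: ennreal_mult[symmetric] ennreal_plus[symmetric] ennreal_leI del: ennreal_plus)
  also have "\<dots> = ennreal (2 powr p) * ((\<integral>\<^sup>+w. ennreal (d a (fst w) powr p) \<partial>\<gamma>) + (\<integral>\<^sup>+w. ennreal (d a (snd w) powr p) \<partial>\<gamma>))"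
    by (simp add: nn_integral_cmult nn_integral_add)
  also have "(\<integral>\<^sup>+w. ennreal (d a (fst w) powr p) \<partial>\<gamma>) = (\<integral>\<^sup>+x. ennreal (d a x powr p) \<partial>\<mu>)"
    using \<gamma> nn_integral_distr_borel[OF \<gamma>', of fst "\<lambda>x. ennreal (d a x powr p)"] by (simp add: couplings_iff)
  also have "(\<integral>\<^sup>+w. ennreal (d a (snd w) powr p) \<partial>\<gamma>) = (\<integral>\<^sup>+x. ennreal (d a x powr p) \<partial>\<nu>)"
    using \<gamma> nn_integral_distr_borel[OF \<gamma>', of snd "\<lambda>x. ennreal (d a x powr p)"] by (simp add: couplings_iff)
  finally show ?thesis
    using moment_finite[OF \<mu>, of a] moment_finite[OF \<nu>, of a]
    by (auto simp: ennreal_mult_less_top elim!: le_less_trans)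
qed

text \<open>
  A bound on \<open>Wp\<close> bounds the infimum of the costs only if that infimum is finite, because \<open>enn2real\<close>
  sends infinity to 0. The product measure is a coupling of finite cost.
\<close>

lemma Wp_lessE:
  assumes \<mu>: "\<mu> \<in> Pp p d" and \<nu>: "\<nu> \<in> Pp p d" and W: "Wp p d \<mu> \<nu> < r"
  obtains \<gamma> where "\<gamma> \<in> couplings \<mu> \<nu>" "transport_cost p d \<gamma> < ennreal (r powr p)"
proof -
  define I where "I = (INF \<gamma>\<in>couplings \<mu> \<nu>. transport_cost p d \<gamma>)"
  have c: "\<mu> \<Otimes>\<^sub>M \<nu> \<in> couplings \<mu> \<nu>"
    using \<mu> \<nu> by (intro product_coupling Pp_borel_probs)
  have "I \<le> transport_cost p d (\<mu> \<Otimes>\<^sub>M \<nu>)" unfolding I_def using c by (rule INF_lower)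
  also have "\<dots> < \<infinity>" by (rule coupling_cost_finite[OF \<mu> \<nu> c])
  finally have fin: "I < top" by simp
  have "enn2real I = (enn2real I powr (1 / p)) powr p" using p_ge_1 by (simp add: powr_powr)
  also have "\<dots> < r powr p"
    using W p_ge_1 by (intro powr_less_mono2) (auto simp: Wp_transport_cost I_def)
  finally have "ennreal (enn2real I) < ennreal (r powr p)" by (simp add: ennreal_less_iff)
  then have "I < ennreal (r powr p)" using fin by simp
  then show thesis unfolding I_def INF_less_iff using that by blast
qed

lemma Wp_le:
  assumes "\<gamma> \<in> couplings \<mu> \<nu>" "transport_cost p d \<gamma> \<le> ennreal (r powr p)" "0 \<le> r"
  shows "Wp p d \<mu> \<nu> \<le> r"
proof -
  let ?I = "INF \<gamma>\<in>couplings \<mu> \<nu>. transport_cost p d \<gamma>"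
  have "?I \<le> ennreal (r powr p)" using assms(1,2) by (rule INF_lower2)
  then have "enn2real ?I \<le> r powr p" by (rule enn2real_leI[rotated]) simp
  then have "enn2real ?I powr (1 / p) \<le> (r powr p) powr (1 / p)"
    using p_ge_1 by (intro powr_mono2) auto
  then show ?thesis using assms(3) p_ge_1 by (simp add: Wp_transport_cost powr_powr)
qed

lemma swap_coupling:
  assumes "\<gamma> \<in> couplings \<mu> \<nu>"
  shows "distr \<gamma> borel (\<lambda>w. (snd w, fst w)) \<in> couplings \<nu> \<mu>"
    and "transport_cost p d (distr \<gamma> borel (\<lambda>w. (snd w, fst w))) = transport_cost p d \<gamma>"
proof -
  have \<gamma>: "\<gamma> \<in> borel_probs" using assms by (simp add: couplings_iff)
  have [measurable]: "(\<lambda>w. (snd w, fst w)) \<in> (borel :: ('a \<times> 'a) measure) \<rightarrow>\<^sub>M borel" by measurable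
  show "distr \<gamma> borel (\<lambda>w. (snd w, fst w)) \<in> couplings \<nu> \<mu>"
    using assms by (simp add: couplings_iff distr_borel_probs distr_distr_borel)
  have "transport_cost p d (distr \<gamma> borel (\<lambda>w. (snd w, fst w))) = (\<integral>\<^sup>+w. ennreal (d (snd w) (fst w) powr p) \<partial>\<gamma>)"
    unfolding transport_cost_def by (subst nn_integral_distr_borel[OF \<gamma>]) (simp_all, measurable)
  then show "transport_cost p d (distr \<gamma> borel (\<lambda>w. (snd w, fst w))) = transport_cost p d \<gamma>"
    by (simp add: transport_cost_def d_commute[of "snd _" "fst _"])
qed

lemma Wp_commute: "Wp p d \<mu> \<nu> = Wp p d \<nu> \<mu>"
proof -
  have "(INF \<gamma>\<in>couplings \<mu> \<nu>. transport_cost p d \<gamma>) \<le> (INF \<gamma>\<in>couplings \<nu> \<mu>. transport_cost p d \<gamma>)" for \<mu> \<nu> :: "'a measure"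
  proof (rule INF_greatest)
    fix \<gamma> assume "\<gamma> \<in> couplings \<nu> \<mu>"
    then show "(INF \<gamma>\<in>couplings \<mu> \<nu>. transport_cost p d \<gamma>) \<le> transport_cost p d \<gamma>"
      by (rule INF_lower2[OF swap_coupling(1)]) (simp add: swap_coupling(2)[OF \<open>\<gamma> \<in> couplings \<nu> \<mu>\<close>])
  qed
  from antisym[OF this this] show ?thesis unfolding Wp_transport_cost by (rule arg_cong)
qed

lemma Wp_refl: "\<mu> \<in> borel_probs \<Longrightarrow> Wp p d \<mu> \<mu> = 0"
proof -
  assume \<mu>: "\<mu> \<in> borel_probs"
  have [measurable]: "(\<lambda>x. (x, x)) \<in> (borel :: 'a measure) \<rightarrow>\<^sub>M borel" by measurable
  have "distr \<mu> borel (\<lambda>x. (x, x)) \<in> couplings \<mu> \<mu>"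
    using \<mu> by (simp add: couplings_iff distr_borel_probs distr_distr_borel distr_id2 borel_probs_sets)
  moreover have "transport_cost p d (distr \<mu> borel (\<lambda>x. (x, x))) = 0"
    unfolding transport_cost_def by (subst nn_integral_distr_borel[OF \<mu>]) (simp_all, measurable)
  ultimately have "Wp p d \<mu> \<mu> \<le> 0" by (intro Wp_le) auto
  then show ?thesis by (simp add: Wp_transport_cost)
qed

text \<open>
  A compact subset \<open>K\<close> of an open set \<open>U\<close> keeps a positive distance \<open>r\<close> from the complement, so any
  coupling carries the mass of \<open>K\<close> into \<open>U\<close> except for pairs that are at least \<open>r\<close> apart. For nearly
  optimal couplings these have arbitrarily small mass, and regularity passes from \<open>K\<close> and \<open>U\<close> to
  all Borel sets.
\<close>

lemma Wp_zero_imp_emeasure_le: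
  assumes \<mu>: "\<mu> \<in> Pp p d" and \<nu>: "\<nu> \<in> Pp p d" and W: "Wp p d \<mu> \<nu> = 0" and B: "B \<in> sets borel"
  shows "emeasure \<mu> B \<le> emeasure \<nu> B"
proof -
  note \<mu>' = Pp_borel_probs[OF \<mu>] and \<nu>' = Pp_borel_probs[OF \<nu>]
  interpret \<mu>: prob_space \<mu> using \<mu>' by (rule borel_probs_prob_space)
  interpret \<nu>: prob_space \<nu> using \<nu>' by (rule borel_probs_prob_space)
  have le: "emeasure \<mu> K \<le> emeasure \<nu> U" if K: "compact K" and U: "open U" and KU: "K \<subseteq> U" for K U
  proof (rule ennreal_le_epsilon)
    fix e :: real assume "0 < e"
    obtain r where r: "0 < r" "\<And>x y. x \<in> K \<Longrightarrow> d x y < r \<Longrightarrow> y \<in> U"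
      by (rule compact_subset_open_margin[OF K U KU]) (rule that, assumption, blast)
    \<comment> \<open>the scale at which Markov's inequality gives the bound \<open>e\<close>\<close>
    have "Wp p d \<mu> \<nu> < r * e powr (1 / p)" using W r(1) \<open>0 < e\<close> by simp
    then obtain \<gamma> where \<gamma>: "\<gamma> \<in> couplings \<mu> \<nu>" "transport_cost p d \<gamma> < ennreal ((r * e powr (1 / p)) powr p)"
      by (rule Wp_lessE[OF \<mu> \<nu>])
    have pow: "(r * e powr (1 / p)) powr p = r powr p * e"
      using r(1) \<open>0 < e\<close> p_ge_1 by (simp add: powr_mult powr_powr)
    have \<gamma>': "\<gamma> \<in> borel_probs" using \<gamma> by (simp add: couplings_iff)
    note [measurable_cong] = borel_probs_sets[OF \<gamma>'] and sp = borel_probs_space[OF \<gamma>']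
    have [measurable]: "K \<in> sets borel" "U \<in> sets borel" using K U by (auto intro: borel_compact)
    have "emeasure \<mu> K = emeasure \<gamma> {w. fst w \<in> K}"
      using \<gamma>(1) emeasure_distr_borel[OF \<gamma>', of fst K] by (simp add: couplings_iff)
    also have "\<dots> \<le> emeasure \<gamma> ({w \<in> space \<gamma>. snd w \<in> U} \<union> {w \<in> space \<gamma>. r \<le> d (fst w) (snd w)})"
    proof (rule emeasure_mono)
      show "{w :: 'a \<times> 'a. fst w \<in> K} \<subseteq> {w \<in> space \<gamma>. snd w \<in> U} \<union> {w \<in> space \<gamma>. r \<le> d (fst w) (snd w)}"
      proof
        fix w :: "'a \<times> 'a" assume "w \<in> {w. fst w \<in> K}"
        then show "w \<in> {w \<in> space \<gamma>. snd w \<in> U} \<union> {w \<in> space \<gamma>. r \<le> d (fst w) (snd w)}"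
          using r(2)[of "fst w" "snd w"] by (cases "d (fst w) (snd w) < r") (simp_all add: sp)
      qed
    qed measurable
    also have "\<dots> \<le> emeasure \<gamma> {w \<in> space \<gamma>. snd w \<in> U} + emeasure \<gamma> {w \<in> space \<gamma>. r \<le> d (fst w) (snd w)}"
      by (rule emeasure_subadditive) measurable
    also have "emeasure \<gamma> {w \<in> space \<gamma>. snd w \<in> U} = emeasure \<nu> U"
      using \<gamma>(1) emeasure_distr_borel[OF \<gamma>', of snd U] by (simp add: couplings_iff sp)
    also have "emeasure \<gamma> {w \<in> space \<gamma>. r \<le> d (fst w) (snd w)} \<le> ennreal e"
      using far_apart_emeasure_le[OF \<gamma>' r(1), of p e] \<gamma>(2) p_ge_1 \<open>0 < e\<close> by (simp add: sp pow)
    finally show "emeasure \<mu> K \<le> emeasure \<nu> U + ennreal e" by (simp add: add_left_mono)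
  qed
  have "emeasure \<mu> B = (SUP K \<in> {K. K \<subseteq> B \<and> compact K}. emeasure \<mu> K)"
    using \<mu>' B by (intro inner_regular) (auto simp: borel_probs_sets)
  also have "\<dots> \<le> (INF U \<in> {U. B \<subseteq> U \<and> open U}. emeasure \<nu> U)"
    by (intro SUP_least INF_greatest) (auto intro!: le)
  also have "\<dots> = emeasure \<nu> B"
    using \<nu>' B by (intro outer_regular[symmetric]) (auto simp: borel_probs_sets)
  finally show ?thesis .
qed

text \<open>
  Nearly optimal couplings are glued along \<open>\<nu>\<close>. The margin \<open>e / 2\<close> serves also to make the bounds \<open>A\<close>
  and \<open>B\<close> positive, as Minkowski's inequality in the present form needs.
\<close>

lemma Wp_triangle:
  assumes \<mu>: "\<mu> \<in> Pp p d" and \<nu>: "\<nu> \<in> Pp p d" and \<sigma>: "\<sigma> \<in> Pp p d"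
  shows "Wp p d \<mu> \<sigma> \<le> Wp p d \<mu> \<nu> + Wp p d \<nu> \<sigma>"
proof (rule field_le_epsilon)
  fix e :: real assume e: "0 < e"
  define A B where "A = Wp p d \<mu> \<nu> + e / 2" and "B = Wp p d \<nu> \<sigma> + e / 2"
  have "0 \<le> Wp p d \<mu> \<nu>" "0 \<le> Wp p d \<nu> \<sigma>" by (simp_all add: Wp_transport_cost)
  then have AB: "0 < A" "0 < B" using e by (simp_all add: A_def B_def)
  obtain \<gamma> where \<gamma>: "\<gamma> \<in> couplings \<mu> \<nu>" "transport_cost p d \<gamma> < ennreal (A powr p)"
    by (rule Wp_lessE[OF \<mu> \<nu>, of A]) (use e in \<open>simp add: A_def\<close>)
  obtain \<eta> where \<eta>: "\<eta> \<in> couplings \<nu> \<sigma>" "transport_cost p d \<eta> < ennreal (B powr p)"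
    by (rule Wp_lessE[OF \<nu> \<sigma>, of B]) (use e in \<open>simp add: B_def\<close>)
  have \<gamma>': "\<gamma> \<in> borel_probs" and \<eta>': "\<eta> \<in> borel_probs" using \<gamma> \<eta> by (auto simp: couplings_iff)
  define \<omega> where "\<omega> = ci_prod \<gamma> \<eta>"
  have \<omega>: "\<omega> \<in> borel_probs" unfolding \<omega>_def by (rule ci_prod_borel_probs[OF \<gamma>' \<eta>'])
  note [measurable_cong] = borel_probs_sets[OF \<omega>]
  have m [measurable]: "(\<lambda>w. (fst w, fst (snd w))) \<in> (borel :: ('a \<times> 'a \<times> 'a) measure) \<rightarrow>\<^sub>M borel"
    "(\<lambda>w. (fst w, snd (snd w))) \<in> (borel :: ('a \<times> 'a \<times> 'a) measure) \<rightarrow>\<^sub>M borel" by measurable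
  have left: "distr \<omega> borel (\<lambda>w. (fst w, fst (snd w))) = \<gamma>"
    unfolding \<omega>_def by (rule distr_ci_prod_left[OF \<gamma>' \<eta>'])
  have right: "distr \<omega> borel snd = \<eta>"
    unfolding \<omega>_def using \<gamma> \<eta> by (intro distr_ci_prod_right[OF \<gamma>' \<eta>']) (simp add: couplings_iff)
  have "distr \<omega> borel fst = \<mu>"
    using \<gamma>(1) distr_distr_borel[OF \<omega> m(1), of fst] by (simp add: left couplings_iff)
  moreover have "distr \<omega> borel (\<lambda>w. snd (snd w)) = \<sigma>"
    using \<eta>(1) distr_distr_borel[OF \<omega>, of snd snd] by (simp add: right couplings_iff)
  ultimately have "distr \<omega> borel (\<lambda>w. (fst w, snd (snd w))) \<in> couplings \<mu> \<sigma>"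
    by (simp add: couplings_iff distr_borel_probs[OF \<omega>] distr_distr_borel[OF \<omega>])
  moreover have "transport_cost p d (distr \<omega> borel (\<lambda>w. (fst w, snd (snd w)))) \<le> ennreal ((A + B) powr p)"
  proof -
    have "transport_cost p d (distr \<omega> borel (\<lambda>w. (fst w, snd (snd w)))) = (\<integral>\<^sup>+w. ennreal (d (fst w) (snd (snd w)) powr p) \<partial>\<omega>)"
      unfolding transport_cost_def by (subst nn_integral_distr_borel[OF \<omega>]) (simp_all, measurable)
    also have "\<dots> \<le> (\<integral>\<^sup>+w. ennreal ((d (fst w) (fst (snd w)) + d (fst (snd w)) (snd (snd w))) powr p) \<partial>\<omega>)"
      using p_ge_1 d_triangle d_nonneg by (intro nn_integral_mono ennreal_leI powr_mono2) auto
    also have "\<dots> \<le> ennreal ((A + B) powr p)"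
    proof (rule nn_integral_Minkowski[OF p_ge_1 AB])
      have "transport_cost p d \<gamma> = (\<integral>\<^sup>+w. ennreal (d (fst w) (fst (snd w)) powr p) \<partial>\<omega>)"
        unfolding transport_cost_def left[symmetric] by (subst nn_integral_distr_borel[OF \<omega>]) (simp_all, measurable)
      then show "(\<integral>\<^sup>+w. ennreal (d (fst w) (fst (snd w)) powr p) \<partial>\<omega>) \<le> ennreal (A powr p)" using \<gamma>(2) by simp
      have "transport_cost p d \<eta> = (\<integral>\<^sup>+w. ennreal (d (fst (snd w)) (snd (snd w)) powr p) \<partial>\<omega>)"
        unfolding transport_cost_def right[symmetric] by (subst nn_integral_distr_borel[OF \<omega>]) (simp_all, measurable)
      then show "(\<integral>\<^sup>+w. ennreal (d (fst (snd w)) (snd (snd w)) powr p) \<partial>\<omega>) \<le> ennreal (B powr p)" using \<eta>(2) by simp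
    qed (simp_all add: d_nonneg)
    finally show ?thesis .
  qed
  ultimately have "Wp p d \<mu> \<sigma> \<le> A + B" using AB by (intro Wp_le) auto
  then show "Wp p d \<mu> \<sigma> \<le> Wp p d \<mu> \<nu> + Wp p d \<nu> \<sigma> + e" by (simp add: A_def B_def)
qed

text \<open>
  The metric axioms give access to the description of the topology by balls: the topology
  \<open>Wp_topology\<close> is specified through the locale of metric spaces.
\<close>

proposition Metric_space_Wp: "Metric_space (Pp p d) (Wp p d)"
proof
  show "Wp p d \<mu> \<nu> = 0 \<longleftrightarrow> \<mu> = \<nu>" if "\<mu> \<in> Pp p d" "\<nu> \<in> Pp p d" for \<mu> \<nu>
  proof
    assume W: "Wp p d \<mu> \<nu> = 0"
    show "\<mu> = \<nu>"
    proof (rule measure_eqI)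
      show "sets \<mu> = sets \<nu>" using that by (simp add: Pp_def)
      fix A assume "A \<in> sets \<mu>"
      then have A: "A \<in> sets borel" using that by (simp add: Pp_def)
      show "emeasure \<mu> A = emeasure \<nu> A"
        using Wp_zero_imp_emeasure_le[OF that W A] Wp_zero_imp_emeasure_le[OF that(2,1) _ A] W
        by (simp add: Wp_commute antisym)
    qed
  qed (use that in \<open>simp add: Wp_refl Pp_borel_probs\<close>)
qed (auto simp: Wp_triangle Wp_commute, simp add: Wp_transport_cost)

end

section \<open>Product metrics are compatible\<close>

lemma compatible_metric_dist: "compatible_metric (dist :: 'a::polish_space \<Rightarrow> 'a \<Rightarrow> real)"
proof
  show "dist x z \<le> dist x y + dist y z" for x y z :: 'a by (rule dist_triangle)
  show "\<exists>r>0. \<forall>y. dist x y < r \<longrightarrow> y \<in> U" if "open U" "x \<in> U" for x :: 'a and U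
    using that unfolding open_dist by (metis dist_commute)
qed (auto simp: dist_commute intro!: continuous_intros)

lemma Minkowski2:
  fixes p a1 a2 b1 b2 :: real
  assumes p: "1 \<le> p" and nn: "0 \<le> a1" "0 \<le> a2" "0 \<le> b1" "0 \<le> b2"
  shows "((a1 + b1) powr p + (a2 + b2) powr p) powr (1 / p)
    \<le> (a1 powr p + a2 powr p) powr (1 / p) + (b1 powr p + b2 powr p) powr (1 / p)"
proof -
  define A B where "A = (a1 powr p + a2 powr p) powr (1 / p)" and "B = (b1 powr p + b2 powr p) powr (1 / p)"
  have A: "a1 powr p + a2 powr p = A powr p" and B: "b1 powr p + b2 powr p = B powr p"
    using p by (simp_all add: A_def B_def powr_powr)
  have root: "(A powr p) powr (1 / p) = A" "(B powr p) powr (1 / p) = B"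
    using p by (simp_all add: powr_powr A_def B_def)
  have "0 \<le> A" "0 \<le> B" by (simp_all add: A_def B_def)
  then consider "A = 0" | "B = 0" | "0 < A" "0 < B" by linarith
  then have "((a1 + b1) powr p + (a2 + b2) powr p) powr (1 / p) \<le> A + B"
  proof cases
    case 1
    then have "a1 = 0" "a2 = 0" using A p by (auto simp: add_nonneg_eq_0_iff)
    then show ?thesis using B root 1 by simp
  next
    case 2
    then have "b1 = 0" "b2 = 0" using B p by (auto simp: add_nonneg_eq_0_iff)
    then show ?thesis using A root 2 by simp
  next
    case 3
    have "(a1 + b1) powr p + (a2 + b2) powr p \<le>
        (A + B) powr (p - 1) * (A powr (1 - p) * a1 powr p + B powr (1 - p) * b1 powr p) +
        (A + B) powr (p - 1) * (A powr (1 - p) * a2 powr p + B powr (1 - p) * b2 powr p)"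
      using nn by (intro add_mono powr_add_le_convex[OF p _ _ 3])
    also have "\<dots> = (A + B) powr (p - 1) * (A powr (1 - p) * (a1 powr p + a2 powr p) + B powr (1 - p) * (b1 powr p + b2 powr p))"
      by (simp add: algebra_simps)
    also have "\<dots> = (A + B) powr p"
      unfolding A B using 3 by (simp add: powr_add[symmetric] powr_diff)
    finally have "((a1 + b1) powr p + (a2 + b2) powr p) powr (1 / p) \<le> ((A + B) powr p) powr (1 / p)"
      using p by (intro powr_mono2) auto
    then show ?thesis using p 3 by (simp add: powr_powr)
  qed
  then show ?thesis by (simp add: A_def B_def)
qed

lemma lp_dist_alt:
  "lp_dist p d e w w' = (d (fst w) (fst w') powr p + e (snd w) (snd w') powr p) powr (1 / p)"
  by (simp add: lp_dist_def case_prod_unfold)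

lemma lp_dist_powr:
  "0 < p \<Longrightarrow> lp_dist p d e w w' powr p = d (fst w) (fst w') powr p + e (snd w) (snd w') powr p"
  by (simp add: lp_dist_alt powr_powr)

lemma compatible_metric_lp_dist:
  assumes d: "compatible_metric d" and e: "compatible_metric e" and p: "1 \<le> p"
  shows "compatible_metric (lp_dist p d e)"
proof -
  interpret d: compatible_metric d by fact
  interpret e: compatible_metric e by fact
  have le: "d (fst w) (fst w') \<le> lp_dist p d e w w'" "e (snd w) (snd w') \<le> lp_dist p d e w w'" for w w'
  proof -
    have "(d (fst w) (fst w') powr p) powr (1 / p) \<le> lp_dist p d e w w'"
      unfolding lp_dist_alt using p by (intro powr_mono2) auto
    then show "d (fst w) (fst w') \<le> lp_dist p d e w w'" using p by (simp add: powr_powr d.d_nonneg)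
    have "(e (snd w) (snd w') powr p) powr (1 / p) \<le> lp_dist p d e w w'"
      unfolding lp_dist_alt using p by (intro powr_mono2) auto
    then show "e (snd w) (snd w') \<le> lp_dist p d e w w'" using p by (simp add: powr_powr e.d_nonneg)
  qed
  show ?thesis
  proof
    show "0 \<le> lp_dist p d e w w'" for w w' by (simp add: lp_dist_alt)
    show "lp_dist p d e w w' = 0 \<longleftrightarrow> w = w'" for w w'
      using p by (simp add: lp_dist_alt add_nonneg_eq_0_iff d.d_zero e.d_zero prod_eq_iff)
    show "lp_dist p d e w w' = lp_dist p d e w' w" for w w'
      by (simp add: lp_dist_alt d.d_commute[of "fst w"] e.d_commute[of "snd w"])
    show "lp_dist p d e u w \<le> lp_dist p d e u v + lp_dist p d e v w" for u v w
    proof -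
      have "lp_dist p d e u w \<le>
          ((d (fst u) (fst v) + d (fst v) (fst w)) powr p + (e (snd u) (snd v) + e (snd v) (snd w)) powr p) powr (1 / p)"
        unfolding lp_dist_alt using p
        by (intro powr_mono2 add_mono d.d_triangle e.d_triangle d.d_nonneg e.d_nonneg) auto
      also have "\<dots> \<le> lp_dist p d e u v + lp_dist p d e v w"
        unfolding lp_dist_alt by (intro Minkowski2 p d.d_nonneg e.d_nonneg)
      finally show ?thesis .
    qed
    show "continuous_on UNIV (\<lambda>w. lp_dist p d e (fst w) (snd w))"
    proof -
      have c1: "continuous_on UNIV (\<lambda>w. d (fst (fst w)) (fst (snd w)))"
        using continuous_on_compose2[OF d.d_continuous, of UNIV "\<lambda>w. (fst (fst w), fst (snd w))"]
        by (simp add: continuous_on_Pair continuous_on_fst continuous_on_snd)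
      have c2: "continuous_on UNIV (\<lambda>w. e (snd (fst w)) (snd (snd w)))"
        using continuous_on_compose2[OF e.d_continuous, of UNIV "\<lambda>w. (snd (fst w), snd (snd w))"]
        by (simp add: continuous_on_Pair continuous_on_fst continuous_on_snd)
      show ?thesis
        unfolding lp_dist_alt using p d.d_nonneg e.d_nonneg
        by (intro continuous_on_powr' continuous_on_add c1 c2 continuous_on_const) auto
    qed
    fix U :: "('a \<times> 'b) set" and w assume U: "open U" "w \<in> U"
    obtain A B where AB: "open A" "open B" "w \<in> A \<times> B" "A \<times> B \<subseteq> U"
      using U by (rule open_prod_elim)
    have "fst w \<in> A" "snd w \<in> B" using AB(3) by (auto simp: mem_Times_iff)
    obtain r where r: "0 < r" "\<And>y. d (fst w) y < r \<Longrightarrow> y \<in> A"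
      using d.d_nhd[OF AB(1) \<open>fst w \<in> A\<close>] by blast
    obtain s where s: "0 < s" "\<And>y. e (snd w) y < s \<Longrightarrow> y \<in> B"
      using e.d_nhd[OF AB(2) \<open>snd w \<in> B\<close>] by blast
    have "w' \<in> U" if "lp_dist p d e w w' < min r s" for w'
    proof -
      have "fst w' \<in> A" "snd w' \<in> B" using le[of w w'] that by (auto intro!: r(2) s(2))
      then show ?thesis using AB(4) by (auto simp: mem_Times_iff)
    qed
    then show "\<exists>r>0. \<forall>w'. lp_dist p d e w w' < r \<longrightarrow> w' \<in> U"
      using r(1) s(1) by (intro exI[of _ "min r s"]) simp
  qed
qed

section \<open>Measurable maps under cheap self-couplings\<close>

lemma nn_integral_tail_small:
  fixes g :: "'b \<Rightarrow> real"
  assumes [measurable]: "g \<in> borel_measurable M" and fin: "(\<integral>\<^sup>+x. ennreal (g x) \<partial>M) < \<infinity>" and c: "0 < (c::real)"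
  obtains B where "0 < B" "(\<integral>\<^sup>+x. ennreal (g x) * indicator {x. B < g x} x \<partial>M) \<le> ennreal c"
proof -
  have "(\<lambda>n. \<integral>\<^sup>+x. ennreal (g x) * indicator {x. real n < g x} x \<partial>M) \<longlonglongrightarrow> (\<integral>\<^sup>+x. 0 \<partial>M)"
  proof (rule nn_integral_dominated_convergence[where w = "\<lambda>x. ennreal (g x)"])
    show "AE x in M. (\<lambda>n. ennreal (g x) * indicator {x. real n < g x} x) \<longlonglongrightarrow> 0"
    proof (rule AE_I2, rule tendsto_eventually)
      fix x
      obtain k where "g x \<le> real k" using real_arch_simple by blast
      then have "ennreal (g x) * indicator {x. real n < g x} x = 0" if "k \<le> n" for n
        using that by (auto simp: indicator_def)
      then show "\<forall>\<^sub>F n in sequentially. ennreal (g x) * indicator {x. real n < g x} x = 0"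
        by (rule eventually_sequentiallyI)
    qed
  qed (use fin in \<open>auto simp: indicator_def\<close>)
  then have "eventually (\<lambda>n. (\<integral>\<^sup>+x. ennreal (g x) * indicator {x. real n < g x} x \<partial>M) < ennreal c) sequentially"
    by (rule order_tendstoD) (use c in simp)
  then obtain k where k: "\<And>n. k \<le> n \<Longrightarrow> (\<integral>\<^sup>+x. ennreal (g x) * indicator {x. real n < g x} x \<partial>M) < ennreal c"
    by (auto simp: eventually_sequentially)
  show thesis by (rule that[of "real (Suc k)"]) (use k[of "Suc k"] in \<open>auto intro: less_imp_le\<close>)
qed

lemma inner_regular_Diff:
  fixes m :: "'a::polish_space measure"
  assumes m: "m \<in> borel_probs" and A: "A \<in> sets borel" and "0 < (c::real)"
  obtains K where "compact K" "K \<subseteq> A" "emeasure m (A - K) \<le> ennreal c"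
proof -
  interpret prob_space m using m by (rule borel_probs_prob_space)
  have reg: "emeasure m A = (SUP K \<in> {K. K \<subseteq> A \<and> compact K}. emeasure m K)"
    using m A by (intro inner_regular) (auto simp: borel_probs_sets)
  have "\<exists>K\<in>{K. K \<subseteq> A \<and> compact K}. emeasure m A < emeasure m K + ennreal c"
    by (rule SUP_approx_ennreal[OF assms(3) _ reg]) (auto intro!: exI[of _ "{}"])
  then obtain K where K: "K \<subseteq> A" "compact K" "emeasure m A \<le> emeasure m K + ennreal c"
    by (auto dest: less_imp_le)
  have Ks: "K \<in> sets m" using K(2) by (simp add: borel_probs_sets[OF m] borel_compact)
  have "emeasure m (A - K) = emeasure m A - emeasure m K"
    using A K(1) Ks by (intro emeasure_Diff) (auto simp: borel_probs_sets[OF m])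
  also have "\<dots> \<le> ennreal c"
    using K(3) by (simp add: ennreal_minus_le_iff add.commute)
  finally show thesis using K that by blast
qed

context wasserstein
begin

text \<open>
  By inner regularity there are compact sets \<open>K\<close> inside \<open>A\<close> and \<open>L\<close> inside its complement that miss
  little mass. If a pair leaves \<open>A\<close>, then its first point is in \<open>A - K\<close>, or its second point is in
  \<open>- A - L\<close>, or it joins \<open>K\<close> to \<open>L\<close> and has to bridge a positive distance. The first two events are
  controlled by the marginals alone because both marginals of the coupling are \<open>m\<close>; the third one by
  Markov's inequality.
\<close>

lemma coupling_leaves_set_small:
  assumes m: "m \<in> borel_probs" and A: "A \<in> sets borel" and "0 < (c::real)"
  shows "\<exists>\<delta>>0. \<forall>\<pi>\<in>couplings m m. transport_cost p d \<pi> \<le> ennreal \<delta> \<longrightarrow>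
           emeasure \<pi> {w. fst w \<in> A \<and> snd w \<notin> A} \<le> ennreal c"
proof -
  have A': "- A \<in> sets borel" using A by auto
  obtain K where K: "compact K" "K \<subseteq> A" "emeasure m (A - K) \<le> ennreal (c / 3)"
    by (rule inner_regular_Diff[OF m A, of "c / 3"]) (use assms(3) in auto)
  obtain L where L: "compact L" "L \<subseteq> - A" "emeasure m (- A - L) \<le> ennreal (c / 3)"
    by (rule inner_regular_Diff[OF m A', of "c / 3"]) (use assms(3) in auto)
  have "open (- L)" "K \<subseteq> - L" using L K by (auto intro: compact_imp_closed)
  then obtain r where r: "0 < r" "\<And>x y. x \<in> K \<Longrightarrow> d x y < r \<Longrightarrow> y \<in> - L"
    by (rule compact_subset_open_margin[OF K(1)]) (rule that, assumption, blast)
  have [measurable]: "K \<in> sets borel" "L \<in> sets borel" "A \<in> sets borel"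
    using K L A by (auto intro: borel_compact)
  have "emeasure \<pi> {w. fst w \<in> A \<and> snd w \<notin> A} \<le> ennreal c"
    if \<pi>: "\<pi> \<in> couplings m m" and cost: "transport_cost p d \<pi> \<le> ennreal (r powr p * (c / 3))" for \<pi>
  proof -
    have \<pi>': "\<pi> \<in> borel_probs" and marg: "distr \<pi> borel fst = m" "distr \<pi> borel snd = m"
      using \<pi> by (auto simp: couplings_iff)
    note [measurable_cong] = borel_probs_sets[OF \<pi>'] and sp = borel_probs_space[OF \<pi>']
    let ?P = "{w \<in> space \<pi>. fst w \<in> A - K}" and ?Q = "{w \<in> space \<pi>. snd w \<in> - A - L}"
      and ?R = "{w \<in> space \<pi>. r \<le> d (fst w) (snd w)}"
    have "emeasure \<pi> {w. fst w \<in> A \<and> snd w \<notin> A} \<le> emeasure \<pi> (?P \<union> (?Q \<union> ?R))"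
    proof (rule emeasure_mono)
      show "{w. fst w \<in> A \<and> snd w \<notin> A} \<subseteq> ?P \<union> (?Q \<union> ?R)"
      proof
        fix w :: "'a \<times> 'a" assume "w \<in> {w. fst w \<in> A \<and> snd w \<notin> A}"
        then show "w \<in> ?P \<union> (?Q \<union> ?R)"
          using r(2)[of "fst w" "snd w"] by (cases "d (fst w) (snd w) < r") (auto simp: sp)
      qed
    qed measurable
    also have "\<dots> \<le> emeasure \<pi> ?P + emeasure \<pi> (?Q \<union> ?R)"
      by (rule emeasure_subadditive) measurable
    also have "\<dots> \<le> emeasure \<pi> ?P + (emeasure \<pi> ?Q + emeasure \<pi> ?R)"
      by (intro add_left_mono emeasure_subadditive) measurable
    also have "emeasure \<pi> ?P = emeasure m (A - K)"
      using emeasure_distr_borel[OF \<pi>', of fst "A - K"] by (simp add: marg sp)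
    also have "emeasure \<pi> ?Q = emeasure m (- A - L)"
      using emeasure_distr_borel[OF \<pi>', of snd "- A - L"] by (simp add: marg sp)
    also have "emeasure m (A - K) + (emeasure m (- A - L) + emeasure \<pi> ?R)
        \<le> ennreal (c / 3) + (ennreal (c / 3) + ennreal (c / 3))"
      using far_apart_emeasure_le[OF \<pi>' r(1) _ _ cost] assms(3) p_ge_1
      by (intro add_mono K L) (simp add: sp)
    also have "\<dots> = ennreal c"
      using assms(3) by (simp add: ennreal_plus[symmetric] del: ennreal_plus)
    finally show ?thesis .
  qed
  then show ?thesis using r(1) assms(3) by (intro exI[of _ "r powr p * (c / 3)"]) auto
qed

text \<open>
  The target is cut into countably many pieces within which distances are below \<open>s\<close>, and \<open>I y\<close> is the
  index of the piece that contains \<open>f y\<close>. If \<open>f\<close> takes values at distance at least \<open>s\<close> on a pair, then the index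
  changes along the pair: either the index of the first point is large, which is unlikely, or the
  pair leaves one of finitely many Borel sets.
\<close>

lemma coupling_moves_function_small_in_measure:
  fixes e :: "'c::polish_space \<Rightarrow> 'c \<Rightarrow> real"
  assumes m: "m \<in> borel_probs" and e: "compatible_metric e"
    and f [measurable]: "f \<in> borel \<rightarrow>\<^sub>M borel" and "0 < s" and c: "0 < (c::real)"
  shows "\<exists>\<delta>>0. \<forall>\<pi>\<in>couplings m m. transport_cost p d \<pi> \<le> ennreal \<delta> \<longrightarrow>
           emeasure \<pi> {w. s \<le> e (f (fst w)) (f (snd w))} \<le> ennreal c"
proof -
  interpret e: compatible_metric e by (rule e)
  interpret m: prob_space m using m by (rule borel_probs_prob_space)
  note m_cong [measurable_cong] = borel_probs_sets[OF m]
  obtain S :: "'c set" where S: "countable S" "\<And>U. open U \<Longrightarrow> U \<noteq> {} \<Longrightarrow> \<exists>s\<in>S. s \<in> U"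
    using countable_dense_exists by blast
  have "S \<noteq> {}" using S(2)[of UNIV] by auto
  define D where "D = from_nat_into S"
  have dense: "\<exists>n. e z (D n) < s / 2" for z
  proof -
    have "z \<in> {x. e z x < s / 2}" using \<open>0 < s\<close> by simp
    then obtain x where "x \<in> S" "e z x < s / 2" using S(2)[OF e.open_d_ball] by blast
    then show ?thesis using from_nat_into_surj[OF S(1) \<open>x \<in> S\<close>] unfolding D_def by blast
  qed
  define I where "I y = (LEAST n. e (f y) (D n) < s / 2)" for y
  have I: "e (f y) (D (I y)) < s / 2" for y
    unfolding I_def by (rule LeastI_ex) (rule dense)
  have [measurable]: "I \<in> borel \<rightarrow>\<^sub>M count_space UNIV"
    unfolding I_def by measurable
  have close: "e (f y) (f y') < s" if "I y = I y'" for y y'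
    using e.d_triangle[of "f y" "f y'" "D (I y)"] I[of y] I[of y'] that e.d_commute[of "f y'" "D (I y)"] by simp
  have tail: "\<exists>N. emeasure m {y. N \<le> I y} \<le> ennreal (c / 2)"
  proof -
    have "(\<lambda>N. emeasure m {y \<in> space m. N \<le> I y}) \<longlonglongrightarrow> emeasure m (\<Inter>N. {y \<in> space m. N \<le> I y})"
      by (rule Lim_emeasure_decseq) (auto simp: decseq_def)
    moreover have "(\<Inter>N. {y \<in> space m. N \<le> I y}) = {}"
      using not_less_eq_eq by blast
    ultimately have "(\<lambda>N. emeasure m {y. N \<le> I y}) \<longlonglongrightarrow> 0" by (simp add: borel_probs_space[OF m])
    then have "eventually (\<lambda>N. emeasure m {y. N \<le> I y} < ennreal (c / 2)) sequentially"
      by (rule order_tendstoD) (use c in simp)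
    then show ?thesis by (auto simp: eventually_sequentially intro: less_imp_le)
  qed
  then obtain N where N: "emeasure m {y. N \<le> I y} \<le> ennreal (c / 2)" by blast
  define c' where "c' = c / (2 * real (Suc N))"
  have "0 < c'" using c by (simp add: c'_def)
  have "\<forall>i. \<exists>\<delta>>0. \<forall>\<pi>\<in>couplings m m. transport_cost p d \<pi> \<le> ennreal \<delta> \<longrightarrow>
           emeasure \<pi> {w. fst w \<in> {y. I y = i} \<and> snd w \<notin> {y. I y = i}} \<le> ennreal c'"
    by (intro allI coupling_leaves_set_small[OF m _ \<open>0 < c'\<close>]) measurable
  from choice[OF this] obtain \<Delta> where \<Delta>: "\<And>i. 0 < \<Delta> i"
    "\<And>i \<pi>. \<pi> \<in> couplings m m \<Longrightarrow> transport_cost p d \<pi> \<le> ennreal (\<Delta> i) \<Longrightarrow>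
        emeasure \<pi> {w. I (fst w) = i \<and> I (snd w) \<noteq> i} \<le> ennreal c'"
    by auto
  \<comment> \<open>the index \<open>N\<close> is included to keep the set nonempty when \<open>N = 0\<close>\<close>
  define \<delta> where "\<delta> = Min (\<Delta> ` {..N})"
  have \<delta>: "0 < \<delta>" "\<And>i. i < N \<Longrightarrow> \<delta> \<le> \<Delta> i"
    by (auto simp: \<delta>_def \<Delta>(1))
  have "emeasure \<pi> {w. s \<le> e (f (fst w)) (f (snd w))} \<le> ennreal c"
    if \<pi>: "\<pi> \<in> couplings m m" and cost: "transport_cost p d \<pi> \<le> ennreal \<delta>" for \<pi>
  proof -
    have \<pi>': "\<pi> \<in> borel_probs" and marg: "distr \<pi> borel fst = m" using \<pi> by (auto simp: couplings_iff)
    note [measurable_cong] = borel_probs_sets[OF \<pi>'] and sp = borel_probs_space[OF \<pi>']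
    let ?T = "{w \<in> space \<pi>. N \<le> I (fst w)}" and ?E = "\<lambda>i. {w \<in> space \<pi>. I (fst w) = i \<and> I (snd w) \<noteq> i}"
    have "emeasure \<pi> {w. s \<le> e (f (fst w)) (f (snd w))} \<le> emeasure \<pi> (?T \<union> (\<Union>i<N. ?E i))"
    proof (rule emeasure_mono)
      show "{w. s \<le> e (f (fst w)) (f (snd w))} \<subseteq> ?T \<union> (\<Union>i<N. ?E i)"
      proof
        fix w :: "'a \<times> 'a" assume "w \<in> {w. s \<le> e (f (fst w)) (f (snd w))}"
        then have "I (fst w) \<noteq> I (snd w)" using close[of "fst w" "snd w"] by auto
        then show "w \<in> ?T \<union> (\<Union>i<N. ?E i)" by (cases "N \<le> I (fst w)") (auto simp: sp)
      qed
    qed measurable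
    also have "\<dots> \<le> emeasure \<pi> ?T + emeasure \<pi> (\<Union>i<N. ?E i)"
      by (rule emeasure_subadditive) measurable
    also have "\<dots> \<le> emeasure \<pi> ?T + (\<Sum>i<N. emeasure \<pi> (?E i))"
    proof (intro add_left_mono emeasure_subadditive_finite)
      have "?E i \<in> sets \<pi>" for i by measurable
      then show "?E ` {..<N} \<subseteq> sets \<pi>" by (rule image_subsetI)
    qed simp
    also have "\<dots> \<le> ennreal (c / 2) + (\<Sum>i<N. ennreal c')"
    proof (intro add_mono sum_mono)
      have "{y. N \<le> I y} \<in> sets borel" by measurable
      then show "emeasure \<pi> ?T \<le> ennreal (c / 2)"
        using emeasure_distr_borel[OF \<pi>', of fst "{y. N \<le> I y}"] N by (simp add: marg sp)
      fix i assume "i \<in> {..<N}"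
      then have "transport_cost p d \<pi> \<le> ennreal (\<Delta> i)"
        using cost \<delta>(2)[of i] by (auto intro: order.trans ennreal_leI)
      then show "emeasure \<pi> (?E i) \<le> ennreal c'" using \<Delta>(2)[OF \<pi>, of i] by (simp add: sp)
    qed
    also have "\<dots> = ennreal (c / 2 + real N * c')"
      using c \<open>0 < c'\<close> by (simp add: ennreal_plus ennreal_mult ennreal_of_nat_eq_real_of_nat)
    also have "\<dots> \<le> ennreal c"
      using c by (intro ennreal_leI) (simp add: c'_def field_simps)
    finally show ?thesis .
  qed
  then show ?thesis using \<delta>(1) by blast
qed

text \<open>
  The step from convergence in measure to convergence in \<open>L\<^sup>p\<close> is uniform integrability. On the event \<open>E\<close>
  where the values of \<open>f\<close> differ by \<open>s\<close> or more, their distance is controlled by the moments \<open>g\<close> of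
  the two values, and each of these has law independent of the coupling: where \<open>g\<close> is at most \<open>B\<close> it
  contributes at most \<open>B\<close> times the mass of \<open>E\<close>, and where it exceeds \<open>B\<close> it contributes a tail of
  a fixed integrable function.
\<close>

lemma coupling_moves_function_small:
  fixes e :: "'c::polish_space \<Rightarrow> 'c \<Rightarrow> real"
  assumes m: "m \<in> borel_probs" and e: "compatible_metric e"
    and f [measurable]: "f \<in> borel \<rightarrow>\<^sub>M borel"
    and fin: "(\<integral>\<^sup>+y. ennreal (e z0 (f y) powr p) \<partial>m) < \<infinity>" and \<epsilon>: "0 < (\<epsilon>::real)"
  shows "\<exists>\<delta>>0. \<forall>\<pi>\<in>couplings m m. transport_cost p d \<pi> \<le> ennreal \<delta> \<longrightarrow>
           (\<integral>\<^sup>+w. ennreal (e (f (fst w)) (f (snd w)) powr p) \<partial>\<pi>) \<le> ennreal \<epsilon>"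
proof -
  interpret e: compatible_metric e by (rule e)
  note m_cong [measurable_cong] = borel_probs_sets[OF m]
  define g where "g y = e z0 (f y) powr p" for y
  have [measurable]: "g \<in> borel_measurable borel" unfolding g_def by measurable
  have g0: "0 \<le> g y" for y by (simp add: g_def)
  define k :: real where "k = 2 powr p"
  have "0 < k" by (simp add: k_def)
  define c where "c = \<epsilon> / (6 * k)"
  have c: "0 < c" using \<epsilon> \<open>0 < k\<close> by (simp add: c_def)
  obtain B where B: "0 < B" "(\<integral>\<^sup>+y. ennreal (g y) * indicator {y. B < g y} y \<partial>m) \<le> ennreal c"
    by (rule nn_integral_tail_small[of g m c]) (use fin c in \<open>auto simp: g_def\<close>)
  define s where "s = (\<epsilon> / 3) powr (1 / p)"
  have s: "0 < s" "s powr p = \<epsilon> / 3" using \<epsilon> p_ge_1 by (simp_all add: s_def powr_powr)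
  obtain \<delta> where \<delta>: "0 < \<delta>" "\<And>\<pi>. \<pi> \<in> couplings m m \<Longrightarrow> transport_cost p d \<pi> \<le> ennreal \<delta> \<Longrightarrow>
           emeasure \<pi> {w. s \<le> e (f (fst w)) (f (snd w))} \<le> ennreal (c / B)"
    using coupling_moves_function_small_in_measure[OF m e f s(1), of "c / B"] c B(1) by auto
  have "(\<integral>\<^sup>+w. ennreal (e (f (fst w)) (f (snd w)) powr p) \<partial>\<pi>) \<le> ennreal \<epsilon>"
    if \<pi>: "\<pi> \<in> couplings m m" and cost: "transport_cost p d \<pi> \<le> ennreal \<delta>" for \<pi>
  proof -
    have \<pi>': "\<pi> \<in> borel_probs" and marg: "distr \<pi> borel fst = m" "distr \<pi> borel snd = m"
      using \<pi> by (auto simp: couplings_iff)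
    note [measurable_cong] = borel_probs_sets[OF \<pi>'] and sp = borel_probs_space[OF \<pi>']
    interpret \<pi>: prob_space \<pi> using \<pi>' by (rule borel_probs_prob_space)
    define E where "E = {w \<in> space \<pi>. s \<le> e (f (fst w)) (f (snd w))}"
    have [measurable]: "E \<in> sets \<pi>" unfolding E_def by measurable
    have E: "emeasure \<pi> E \<le> ennreal (c / B)" using \<delta>(2)[OF \<pi> cost] by (simp add: E_def sp)
    have part: "(\<integral>\<^sup>+w. ennreal (g (h w)) * indicator E w \<partial>\<pi>) \<le> ennreal (2 * c)"
      if h [measurable]: "h \<in> borel \<rightarrow>\<^sub>M borel" and hm: "distr \<pi> borel h = m" for h
    proof -
      have "(\<integral>\<^sup>+w. ennreal (g (h w)) * indicator E w \<partial>\<pi>) \<le>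
          (\<integral>\<^sup>+w. ennreal B * indicator E w + ennreal (g (h w)) * indicator {y. B < g y} (h w) \<partial>\<pi>)"
        using B(1) by (intro nn_integral_mono) (auto simp: indicator_def not_less intro!: ennreal_leI)
      also have "\<dots> = ennreal B * emeasure \<pi> E + (\<integral>\<^sup>+y. ennreal (g y) * indicator {y. B < g y} y \<partial>m)"
        unfolding hm[symmetric] by (subst nn_integral_distr_borel[OF \<pi>' h], measurable)
          (simp add: nn_integral_add nn_integral_cmult_indicator)
      also have "\<dots> \<le> ennreal B * ennreal (c / B) + ennreal c"
        by (intro add_mono mult_left_mono E B(2)) simp
      also have "\<dots> = ennreal (2 * c)"
        using B(1) c by (simp add: ennreal_mult[symmetric] ennreal_plus[symmetric] del: ennreal_plus)
      finally show ?thesis .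
    qed
    have "(\<integral>\<^sup>+w. ennreal (e (f (fst w)) (f (snd w)) powr p) \<partial>\<pi>) \<le>
      (\<integral>\<^sup>+w. ennreal (\<epsilon> / 3) + ennreal k * (ennreal (g (fst w)) * indicator E w + ennreal (g (snd w)) * indicator E w) \<partial>\<pi>)"
    proof (rule nn_integral_mono)
      fix w
      show "ennreal (e (f (fst w)) (f (snd w)) powr p) \<le>
        ennreal (\<epsilon> / 3) + ennreal k * (ennreal (g (fst w)) * indicator E w + ennreal (g (snd w)) * indicator E w)"
      proof (cases "w \<in> E")
        case True
        have "e (f (fst w)) (f (snd w)) powr p \<le> k * (g (fst w) + g (snd w))"
          using e.quasi_triangle[of p "f (fst w)" "f (snd w)" z0] p_ge_1
          by (simp add: k_def g_def e.d_commute[of _ z0])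
        then have "ennreal (e (f (fst w)) (f (snd w)) powr p) \<le> ennreal k * (ennreal (g (fst w)) + ennreal (g (snd w)))"
          using g0 \<open>0 < k\<close> by (simp add: ennreal_mult[symmetric] ennreal_plus[symmetric] ennreal_leI del: ennreal_plus)
        then show ?thesis using True by (simp add: add_increasing)
      next
        case False
        then have "e (f (fst w)) (f (snd w)) powr p \<le> s powr p"
          using p_ge_1 by (intro powr_mono2) (auto simp: E_def sp e.d_nonneg)
        then show ?thesis using False s(2) by (simp add: ennreal_leI)
      qed
    qed
    also have "\<dots> = ennreal (\<epsilon> / 3) + ennreal k * ((\<integral>\<^sup>+w. ennreal (g (fst w)) * indicator E w \<partial>\<pi>) + (\<integral>\<^sup>+w. ennreal (g (snd w)) * indicator E w \<partial>\<pi>))"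
      by (simp add: nn_integral_add nn_integral_cmult \<pi>.emeasure_space_1)
    also have "\<dots> \<le> ennreal (\<epsilon> / 3) + ennreal k * (ennreal (2 * c) + ennreal (2 * c))"
      by (intro add_left_mono mult_left_mono add_mono part marg) simp_all
    also have "\<dots> = ennreal (\<epsilon> / 3 + k * (4 * c))"
      using c \<epsilon> \<open>0 < k\<close> by (simp add: ennreal_mult[symmetric] ennreal_plus[symmetric] del: ennreal_plus)
    also have "\<epsilon> / 3 + k * (4 * c) = \<epsilon>" using \<open>0 < k\<close> by (simp add: c_def)
    finally show ?thesis .
  qed
  then show ?thesis using \<delta>(1) by blast
qed

end

section \<open>Continuity of the conditionally independent product\<close>

text \<open>
  The second marginal of \<open>ci_prod \<mu> \<nu>\<close> is \<open>\<nu>\<close>, so almost surely under it the last coordinate is \<open>f\<close> of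
  the middle one; hence it is determined by its marginal \<open>\<mu>\<close>.
\<close>

lemma ci_prod_graph:
  fixes \<mu> :: "('a::polish_space \<times> 'b::polish_space) measure"
    and \<nu> :: "('b \<times> 'c::polish_space) measure"
  assumes \<mu>: "\<mu> \<in> borel_probs" and \<nu>: "\<nu> \<in> borel_probs"
    and marg: "distr \<mu> borel snd = distr \<nu> borel fst"
    and f [measurable]: "f \<in> borel \<rightarrow>\<^sub>M borel" and graph: "AE w in \<nu>. snd w = f (fst w)"
  shows "ci_prod \<mu> \<nu> = distr \<mu> borel (\<lambda>w. (fst w, snd w, f (snd w)))"
proof -
  let ?\<omega> = "ci_prod \<mu> \<nu>"
  have \<omega>: "?\<omega> \<in> borel_probs" by (rule ci_prod_borel_probs[OF \<mu> \<nu>])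
  note [measurable_cong] = borel_probs_sets[OF \<omega>]
  have p [measurable]: "(\<lambda>w :: 'a \<times> 'b \<times> 'c. (fst w, fst (snd w))) \<in> borel \<rightarrow>\<^sub>M borel"
    "(\<lambda>w :: 'a \<times> 'b. (fst w, snd w, f (snd w))) \<in> borel \<rightarrow>\<^sub>M borel" by measurable
  have "AE w in distr ?\<omega> borel snd. snd w = f (fst w)"
    unfolding distr_ci_prod_right[OF \<mu> \<nu> marg] by (rule graph)
  then have ae: "AE w in ?\<omega>. snd (snd w) = f (fst (snd w))"
    by (subst (asm) AE_distr_borel[OF \<omega>]) measurable
  have "?\<omega> = distr ?\<omega> borel (\<lambda>w. w)"
    by (rule distr_id2[symmetric]) (simp add: borel_probs_sets[OF \<omega>])
  also have "\<dots> = distr ?\<omega> borel (\<lambda>w. (fst w, fst (snd w), f (fst (snd w))))"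
  proof (rule distr_cong_AE)
    show "AE w in ?\<omega>. w = (fst w, fst (snd w), f (fst (snd w)))"
      using ae by eventually_elim (simp add: prod_eq_iff)
  qed (simp_all, measurable)
  also have "\<dots> = distr (distr ?\<omega> borel (\<lambda>w. (fst w, fst (snd w)))) borel (\<lambda>w. (fst w, snd w, f (snd w)))"
    by (simp add: distr_distr_borel[OF \<omega>])
  also have "distr ?\<omega> borel (\<lambda>w. (fst w, fst (snd w))) = \<mu>" by (rule distr_ci_prod_left[OF \<mu> \<nu>])
  finally show ?thesis .
qed

text \<open>
  The coordinates of \<open>\<Omega>\<close> are \<open>(((x, y), x'), ((y', z'), (y'', z'')))\<close>. The coupling \<open>\<gamma>\<close> is the law of
  \<open>((x, y), (x', y'))\<close>, then \<open>z'\<close> is drawn from the kernel of \<open>\<nu>'\<close> at \<open>y'\<close>, so that \<open>(x', y', z')\<close>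
  gets the law \<open>ci_prod \<mu>' \<nu>'\<close>, and finally \<open>(y'', z'')\<close> is drawn conditionally on \<open>(y', z')\<close> so as to
  restore the coupling \<open>\<eta>\<close> as the law of \<open>((y'', z''), (y', z'))\<close>. The two conditional draws are
  two conditionally independent products, after the coordinates have been regrouped.
\<close>

lemma glue_along_ci_prod:
  fixes \<mu> \<mu>' :: "('a::polish_space \<times> 'b::polish_space) measure"
    and \<nu> \<nu>' :: "('b \<times> 'c::polish_space) measure"
  assumes \<gamma>: "\<gamma> \<in> couplings \<mu> \<mu>'" and \<eta>: "\<eta> \<in> couplings \<nu> \<nu>'"
    and marg: "distr \<mu>' borel snd = distr \<nu>' borel fst"
  obtains \<Omega> :: "((('a \<times> 'b) \<times> 'a) \<times> ('b \<times> 'c) \<times> ('b \<times> 'c)) measure" where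
    "\<Omega> \<in> borel_probs"
    "distr \<Omega> borel (\<lambda>w. (fst (fst w), snd (fst w), fst (fst (snd w)))) = \<gamma>"
    "distr \<Omega> borel (\<lambda>w. (snd (snd w), fst (snd w))) = \<eta>"
    "distr \<Omega> borel (\<lambda>w. (snd (fst w), fst (snd w))) = ci_prod \<mu>' \<nu>'"
proof -
  have \<gamma>': "\<gamma> \<in> borel_probs" "distr \<gamma> borel snd = \<mu>'" and \<eta>': "\<eta> \<in> borel_probs" "distr \<eta> borel snd = \<nu>'"
    using \<gamma> \<eta> by (auto simp: couplings_iff)
  have [measurable]: "(\<lambda>w :: ('a \<times> 'b) \<times> 'a \<times> 'b. ((fst w, fst (snd w)), snd (snd w))) \<in> borel \<rightarrow>\<^sub>M borel"
    "(\<lambda>w :: ('b \<times> 'c) \<times> ('b \<times> 'c). (snd w, fst w)) \<in> borel \<rightarrow>\<^sub>M borel" by measurable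
  define \<gamma>r where "\<gamma>r = distr \<gamma> borel (\<lambda>w. ((fst w, fst (snd w)), snd (snd w)))"
  define \<eta>s where "\<eta>s = distr \<eta> borel (\<lambda>w. (snd w, fst w))"
  have \<gamma>r: "\<gamma>r \<in> borel_probs" unfolding \<gamma>r_def by (rule distr_borel_probs[OF \<gamma>'(1)]) measurable
  have \<eta>s: "\<eta>s \<in> borel_probs" unfolding \<eta>s_def by (rule distr_borel_probs[OF \<eta>'(1)]) measurable
  have \<nu>': "\<nu>' \<in> borel_probs" unfolding \<eta>'(2)[symmetric] by (rule distr_borel_probs[OF \<eta>'(1)]) measurable
  define \<Omega>0 where "\<Omega>0 = ci_prod \<gamma>r \<nu>'"
  have \<Omega>0: "\<Omega>0 \<in> borel_probs" unfolding \<Omega>0_def by (rule ci_prod_borel_probs[OF \<gamma>r \<nu>'])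
  define \<Omega> where "\<Omega> = ci_prod \<Omega>0 \<eta>s"
  have \<Omega>: "\<Omega> \<in> borel_probs" unfolding \<Omega>_def by (rule ci_prod_borel_probs[OF \<Omega>0 \<eta>s])
  have \<gamma>r_snd: "distr \<gamma>r borel (\<lambda>w. (snd (fst w), snd w)) = \<mu>'"
    unfolding \<gamma>r_def \<gamma>'(2)[symmetric] by (subst distr_distr_borel[OF \<gamma>'(1)]) (simp_all, measurable)
  have "distr \<gamma>r borel snd = distr \<nu>' borel fst"
    unfolding marg[symmetric] \<gamma>'(2)[symmetric] \<gamma>r_def
    by (simp add: distr_distr_borel[OF \<gamma>'(1)])
  then have \<Omega>0_snd: "distr \<Omega>0 borel snd = \<nu>'"
    unfolding \<Omega>0_def by (rule distr_ci_prod_right[OF \<gamma>r \<nu>'])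
  have \<Omega>0_left: "distr \<Omega>0 borel (\<lambda>w. (fst w, fst (snd w))) = \<gamma>r"
    unfolding \<Omega>0_def by (rule distr_ci_prod_left[OF \<gamma>r \<nu>'])
  have \<Omega>0_ci: "distr \<Omega>0 borel (\<lambda>w. (snd (fst w), snd w)) = ci_prod \<mu>' \<nu>'"
    unfolding \<Omega>0_def by (subst distr_ci_prod_map[OF \<gamma>r \<nu>']) (simp_all add: \<gamma>r_snd)
  have "distr \<eta>s borel fst = \<nu>'"
    unfolding \<eta>s_def \<eta>'(2)[symmetric] by (simp add: distr_distr_borel[OF \<eta>'(1)])
  then have \<Omega>_snd: "distr \<Omega> borel snd = \<eta>s"
    unfolding \<Omega>_def by (intro distr_ci_prod_right[OF \<Omega>0 \<eta>s]) (simp add: \<Omega>0_snd)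
  have \<Omega>_left: "distr \<Omega> borel (\<lambda>w. (fst w, fst (snd w))) = \<Omega>0"
    unfolding \<Omega>_def by (rule distr_ci_prod_left[OF \<Omega>0 \<eta>s])
  have from_\<Omega>0: "distr \<Omega> borel (\<lambda>w. h (fst w, fst (snd w))) = distr \<Omega>0 borel h"
    if "h \<in> borel \<rightarrow>\<^sub>M borel" for h :: "(('a \<times> 'b) \<times> 'a) \<times> 'b \<times> 'c \<Rightarrow> 'e::topological_space"
    unfolding \<Omega>_left[symmetric] by (rule distr_distr_borel[OF \<Omega> _ that, symmetric]) measurable
  show thesis
  proof (rule that[OF \<Omega>])
    let ?h = "\<lambda>w :: (('a \<times> 'b) \<times> 'a) \<times> 'b. (fst (fst w), snd (fst w), snd w)"
    have "distr \<Omega> borel (\<lambda>w. (fst (fst w), snd (fst w), fst (fst (snd w)))) =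
        distr \<Omega>0 borel (\<lambda>w. (fst (fst w), snd (fst w), fst (snd w)))"
      by (subst from_\<Omega>0[symmetric]) (simp_all, measurable)
    also have "\<dots> = distr \<gamma>r borel ?h"
      unfolding \<Omega>0_left[symmetric] by (subst distr_distr_borel[OF \<Omega>0]) (simp_all, measurable)
    also have "\<dots> = distr \<gamma> borel (\<lambda>w. w)"
      unfolding \<gamma>r_def by (subst distr_distr_borel[OF \<gamma>'(1)]) (simp_all, measurable)
    also have "\<dots> = \<gamma>" by (rule distr_id2) (simp add: borel_probs_sets[OF \<gamma>'(1)])
    finally show "distr \<Omega> borel (\<lambda>w. (fst (fst w), snd (fst w), fst (fst (snd w)))) = \<gamma>" .
    have "distr \<Omega> borel (\<lambda>w. (snd (snd w), fst (snd w))) = distr \<eta>s borel (\<lambda>w. (snd w, fst w))"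
      unfolding \<Omega>_snd[symmetric] by (subst distr_distr_borel[OF \<Omega>]) (simp_all, measurable)
    also have "\<dots> = distr \<eta> borel (\<lambda>w. w)"
      unfolding \<eta>s_def by (subst distr_distr_borel[OF \<eta>'(1)]) (simp_all, measurable)
    also have "\<dots> = \<eta>" by (rule distr_id2) (simp add: borel_probs_sets[OF \<eta>'(1)])
    finally show "distr \<Omega> borel (\<lambda>w. (snd (snd w), fst (snd w))) = \<eta>" .
    show "distr \<Omega> borel (\<lambda>w. (snd (fst w), fst (snd w))) = ci_prod \<mu>' \<nu>'"
      unfolding \<Omega>0_ci[symmetric] by (subst from_\<Omega>0[symmetric]) (simp_all, measurable)
  qed
qed

context
  fixes p :: real and dX :: "'x::polish_space \<Rightarrow> 'x \<Rightarrow> real" and dY :: "'y::polish_space \<Rightarrow> 'y \<Rightarrow> real"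
    and dZ :: "'z::polish_space \<Rightarrow> 'z \<Rightarrow> real"
  assumes p: "1 \<le> p" and dX: "compatible_metric dX" and dY: "compatible_metric dY" and dZ: "compatible_metric dZ"
begin

interpretation X: wasserstein dX p using dX p by (simp add: wasserstein_def wasserstein_axioms_def)
interpretation Y: wasserstein dY p using dY p by (simp add: wasserstein_def wasserstein_axioms_def)
interpretation Z: wasserstein dZ p using dZ p by (simp add: wasserstein_def wasserstein_axioms_def)
interpretation XY: wasserstein "lp_dist p dX dY" p
  using compatible_metric_lp_dist[OF dX dY p] p by (simp add: wasserstein_def wasserstein_axioms_def)
interpretation YZ: wasserstein "lp_dist p dY dZ" p
  using compatible_metric_lp_dist[OF dY dZ p] p by (simp add: wasserstein_def wasserstein_axioms_def)
interpretation XYZ: wasserstein "lp_dist p dX (lp_dist p dY dZ)" p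
  using compatible_metric_lp_dist[OF dX compatible_metric_lp_dist[OF dY dZ p] p] p
  by (simp add: wasserstein_def wasserstein_axioms_def)

lemma ci_domD:
  assumes "(\<mu>, \<nu>) \<in> ci_dom p dX dY dZ"
  shows "\<mu> \<in> Pp p (lp_dist p dX dY)" "\<nu> \<in> Pp p (lp_dist p dY dZ)"
    "\<mu> \<in> borel_probs" "\<nu> \<in> borel_probs" "distr \<mu> borel snd = distr \<nu> borel fst"
  using assms by (auto simp: ci_dom_def XY.Pp_borel_probs YZ.Pp_borel_probs)

lemma lp_powr:
  "lp_dist p d e w w' powr p = d (fst w) (fst w') powr p + e (snd w) (snd w') powr p"
  using p by (intro lp_dist_powr) simp

text \<open>
  The moment of the triple product is at most the sum of the moments of \<open>\<mu>\<close> and \<open>\<nu>\<close>, in which the middle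
  coordinate is counted twice.
\<close>

lemma ci_prod_in_Pp:
  assumes D: "(\<mu>, \<nu>) \<in> ci_dom p dX dY dZ"
  shows "ci_prod \<mu> \<nu> \<in> Pp p (lp_dist p dX (lp_dist p dY dZ))"
proof -
  note D' = ci_domD[OF D]
  let ?\<omega> = "ci_prod \<mu> \<nu>"
  have \<omega>: "?\<omega> \<in> borel_probs" by (rule ci_prod_borel_probs[OF D'(3,4)])
  note [measurable_cong] = borel_probs_sets[OF \<omega>]
  define a :: "'x \<times> 'y \<times> 'z" where "a = undefined"
  have m [measurable]: "(\<lambda>w :: 'x \<times> 'y \<times> 'z. (fst w, fst (snd w))) \<in> borel \<rightarrow>\<^sub>M borel" by measurable
  let ?I = "\<integral>\<^sup>+w. ennreal (lp_dist p dX dY (fst a, fst (snd a)) (fst w, fst (snd w)) powr p) \<partial>?\<omega>"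
  let ?J = "\<integral>\<^sup>+w. ennreal (lp_dist p dY dZ (snd a) (snd w) powr p) \<partial>?\<omega>"
  have "(\<integral>\<^sup>+w. ennreal (lp_dist p dX (lp_dist p dY dZ) a w powr p) \<partial>?\<omega>) \<le>
      (\<integral>\<^sup>+w. ennreal (lp_dist p dX dY (fst a, fst (snd a)) (fst w, fst (snd w)) powr p) +
           ennreal (lp_dist p dY dZ (snd a) (snd w) powr p) \<partial>?\<omega>)"
    by (intro nn_integral_mono) (simp add: lp_powr ennreal_plus[symmetric] ennreal_leI del: ennreal_plus)
  also have "\<dots> = ?I + ?J" by (rule nn_integral_add) measurable
  also have "?I = (\<integral>\<^sup>+w. ennreal (lp_dist p dX dY (fst a, fst (snd a)) w powr p) \<partial>\<mu>)"
    using nn_integral_distr_borel[OF \<omega> m, of "\<lambda>w. ennreal (lp_dist p dX dY (fst a, fst (snd a)) w powr p)"]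
    by (simp add: distr_ci_prod_left[OF D'(3,4)])
  also have "?J = (\<integral>\<^sup>+w. ennreal (lp_dist p dY dZ (snd a) w powr p) \<partial>\<nu>)"
    using nn_integral_distr_borel[OF \<omega>, of snd "\<lambda>w. ennreal (lp_dist p dY dZ (snd a) w powr p)"]
    by (simp add: distr_ci_prod_right[OF D'(3,4,5)])
  also have "(\<integral>\<^sup>+w. ennreal (lp_dist p dX dY (fst a, fst (snd a)) w powr p) \<partial>\<mu>) + \<dots> < \<infinity>"
    using XY.moment_finite[OF D'(1)] YZ.moment_finite[OF D'(2)] by simp
  finally show ?thesis using \<omega> unfolding Pp_def borel_probs_iff by blast
qed

text \<open>
  In the notation of the gluing lemma, \<open>\<Theta>\<close> is the law of \<open>((x, y, f y), (x', y', z'))\<close> and \<open>\<pi>\<close> is the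
  law of \<open>(y, y'')\<close>. The point \<open>y\<close> is compared with \<open>y''\<close> through \<open>y'\<close>, and \<open>f y\<close> is compared with \<open>z'\<close>
  through \<open>f y''\<close>, which equals \<open>z''\<close> almost surely because \<open>(y'', z'')\<close> has law \<open>\<nu>\<close>.
\<close>

lemma transport_cost_ci_prod_le:
  assumes D: "(\<mu>, \<nu>) \<in> ci_dom p dX dY dZ" and D': "(\<mu>', \<nu>') \<in> ci_dom p dX dY dZ"
    and f [measurable]: "f \<in> borel \<rightarrow>\<^sub>M borel" and graph: "AE w in \<nu>. snd w = f (fst w)"
    and \<gamma>: "\<gamma> \<in> couplings \<mu> \<mu>'" and \<eta>: "\<eta> \<in> couplings \<nu> \<nu>'"
  obtains \<Theta> \<pi> where "\<Theta> \<in> couplings (ci_prod \<mu> \<nu>) (ci_prod \<mu>' \<nu>')"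
    "\<pi> \<in> couplings (distr \<nu> borel fst) (distr \<nu> borel fst)"
    "transport_cost p dY \<pi> \<le> ennreal (2 powr p) *
       (transport_cost p (lp_dist p dX dY) \<gamma> + transport_cost p (lp_dist p dY dZ) \<eta>)"
    "transport_cost p (lp_dist p dX (lp_dist p dY dZ)) \<Theta> \<le> transport_cost p (lp_dist p dX dY) \<gamma> +
       ennreal (2 powr p) * ((\<integral>\<^sup>+w. ennreal (dZ (f (fst w)) (f (snd w)) powr p) \<partial>\<pi>) +
                             transport_cost p (lp_dist p dY dZ) \<eta>)"
proof -
  note D = ci_domD[OF D] and D' = ci_domD[OF D']
  have \<gamma>': "distr \<gamma> borel fst = \<mu>" "distr \<gamma> borel snd = \<mu>'" and \<eta>': "distr \<eta> borel fst = \<nu>" "distr \<eta> borel snd = \<nu>'"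
    using \<gamma> \<eta> by (auto simp: couplings_iff)
  obtain \<Omega> :: "((('x \<times> 'y) \<times> 'x) \<times> ('y \<times> 'z) \<times> ('y \<times> 'z)) measure" where \<Omega>: "\<Omega> \<in> borel_probs"
    and \<Omega>\<gamma>: "distr \<Omega> borel (\<lambda>w. (fst (fst w), snd (fst w), fst (fst (snd w)))) = \<gamma>"
    and \<Omega>\<eta>: "distr \<Omega> borel (\<lambda>w. (snd (snd w), fst (snd w))) = \<eta>"
    and \<Omega>ci: "distr \<Omega> borel (\<lambda>w. (snd (fst w), fst (snd w))) = ci_prod \<mu>' \<nu>'"
    by (rule glue_along_ci_prod[OF \<gamma> \<eta> D'(5)])
  note [measurable_cong] = borel_probs_sets[OF \<Omega>]
  let ?\<gamma> = "\<lambda>w :: (('x \<times> 'y) \<times> 'x) \<times> ('y \<times> 'z) \<times> ('y \<times> 'z). (fst (fst w), snd (fst w), fst (fst (snd w)))"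
    and ?\<eta> = "\<lambda>w :: (('x \<times> 'y) \<times> 'x) \<times> ('y \<times> 'z) \<times> ('y \<times> 'z). (snd (snd w), fst (snd w))"
    and ?\<theta>1 = "\<lambda>w :: (('x \<times> 'y) \<times> 'x) \<times> ('y \<times> 'z) \<times> ('y \<times> 'z). (fst (fst (fst w)), snd (fst (fst w)), f (snd (fst (fst w))))"
    and ?\<theta>2 = "\<lambda>w :: (('x \<times> 'y) \<times> 'x) \<times> ('y \<times> 'z) \<times> ('y \<times> 'z). (snd (fst w), fst (snd w))"
    and ?\<pi> = "\<lambda>w :: (('x \<times> 'y) \<times> 'x) \<times> ('y \<times> 'z) \<times> ('y \<times> 'z). (snd (fst (fst w)), fst (snd (snd w)))"
  have m: "?\<gamma> \<in> borel \<rightarrow>\<^sub>M borel" "?\<eta> \<in> borel \<rightarrow>\<^sub>M borel" "?\<theta>1 \<in> borel \<rightarrow>\<^sub>M borel" "?\<theta>2 \<in> borel \<rightarrow>\<^sub>M borel"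
    "?\<pi> \<in> borel \<rightarrow>\<^sub>M borel" "(\<lambda>w. (?\<theta>1 w, ?\<theta>2 w)) \<in> borel \<rightarrow>\<^sub>M borel"
    by measurable
  define \<Theta> where "\<Theta> = distr \<Omega> borel (\<lambda>w. (?\<theta>1 w, ?\<theta>2 w))"
  define \<pi> where "\<pi> = distr \<Omega> borel ?\<pi>"
  have \<Omega>\<mu>: "distr \<Omega> borel (\<lambda>w. fst (fst w)) = \<mu>"
    using distr_distr_borel[OF \<Omega> m(1), of fst] by (simp add: \<Omega>\<gamma> \<gamma>')
  have \<Omega>\<nu>: "distr \<Omega> borel (\<lambda>w. snd (snd w)) = \<nu>"
    using distr_distr_borel[OF \<Omega> m(2), of fst] by (simp add: \<Omega>\<eta> \<eta>')
  have "distr \<Omega> borel ?\<theta>1 = ci_prod \<mu> \<nu>"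
    unfolding ci_prod_graph[OF D(3,4,5) f graph]
    by (subst \<Omega>\<mu>[symmetric], subst distr_distr_borel[OF \<Omega>]) (simp_all, measurable)
  then have \<Theta>: "\<Theta> \<in> couplings (ci_prod \<mu> \<nu>) (ci_prod \<mu>' \<nu>')"
    unfolding couplings_iff \<Theta>_def
    using distr_borel_probs[OF \<Omega> m(6)] distr_distr_borel[OF \<Omega> m(6), of fst] distr_distr_borel[OF \<Omega> m(6), of snd]
    by (simp add: \<Omega>ci)
  have "distr \<pi> borel fst = distr \<mu> borel snd"
    unfolding \<pi>_def using distr_distr_borel[OF \<Omega> m(5), of fst] distr_distr_borel[OF \<Omega>, of "\<lambda>w. fst (fst w)" snd]
    by (simp add: \<Omega>\<mu>)
  moreover have "distr \<pi> borel snd = distr \<nu> borel fst"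
    unfolding \<pi>_def using distr_distr_borel[OF \<Omega> m(5), of snd] distr_distr_borel[OF \<Omega>, of "\<lambda>w. snd (snd w)" fst]
    by (simp add: \<Omega>\<nu>)
  ultimately have \<pi>: "\<pi> \<in> couplings (distr \<nu> borel fst) (distr \<nu> borel fst)"
    using distr_borel_probs[OF \<Omega> m(5)] by (simp add: couplings_iff D(5) \<pi>_def)
  have \<gamma>_cost: "transport_cost p (lp_dist p dX dY) \<gamma> =
      (\<integral>\<^sup>+w. ennreal (lp_dist p dX dY (fst (fst w)) (snd (fst w), fst (fst (snd w))) powr p) \<partial>\<Omega>)"
    unfolding transport_cost_def \<Omega>\<gamma>[symmetric] by (subst nn_integral_distr_borel[OF \<Omega> m(1)]) (simp_all, measurable)
  have \<eta>_cost: "transport_cost p (lp_dist p dY dZ) \<eta> =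
      (\<integral>\<^sup>+w. ennreal (lp_dist p dY dZ (snd (snd w)) (fst (snd w)) powr p) \<partial>\<Omega>)"
    unfolding transport_cost_def \<Omega>\<eta>[symmetric] by (subst nn_integral_distr_borel[OF \<Omega> m(2)]) (simp_all, measurable)
  have \<pi>_int: "(\<integral>\<^sup>+w. ennreal (h (fst w) (snd w)) \<partial>\<pi>) = (\<integral>\<^sup>+w. ennreal (h (snd (fst (fst w))) (fst (snd (snd w)))) \<partial>\<Omega>)"
    if "(\<lambda>w. h (fst w) (snd w)) \<in> borel_measurable borel" for h :: "'y \<Rightarrow> 'y \<Rightarrow> real"
    unfolding \<pi>_def using that by (subst nn_integral_distr_borel[OF \<Omega> m(5)]) (simp_all, measurable)
  have "transport_cost p dY \<pi> \<le> (\<integral>\<^sup>+w. ennreal (2 powr p) *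
      (ennreal (lp_dist p dX dY (fst (fst w)) (snd (fst w), fst (fst (snd w))) powr p) +
       ennreal (lp_dist p dY dZ (snd (snd w)) (fst (snd w)) powr p)) \<partial>\<Omega>)"
    unfolding transport_cost_def
  proof (subst \<pi>_int, measurable, rule nn_integral_mono)
    fix w :: "(('x \<times> 'y) \<times> 'x) \<times> ('y \<times> 'z) \<times> ('y \<times> 'z)"
    let ?a = "dY (snd (fst (fst w))) (fst (fst (snd w))) powr p" and ?b = "dY (fst (fst (snd w))) (fst (snd (snd w))) powr p"
    have "dY (snd (fst (fst w))) (fst (snd (snd w))) powr p \<le> 2 powr p * (?a + ?b)"
      using Y.quasi_triangle p by simp
    also have "\<dots> \<le> 2 powr p * (lp_dist p dX dY (fst (fst w)) (snd (fst w), fst (fst (snd w))) powr p +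
        lp_dist p dY dZ (snd (snd w)) (fst (snd w)) powr p)"
      by (intro mult_left_mono) (simp_all add: lp_powr Y.d_commute[of "fst (fst (snd w))"])
    finally show "ennreal (dY (snd (fst (fst w))) (fst (snd (snd w))) powr p) \<le> ennreal (2 powr p) *
      (ennreal (lp_dist p dX dY (fst (fst w)) (snd (fst w), fst (fst (snd w))) powr p) +
       ennreal (lp_dist p dY dZ (snd (snd w)) (fst (snd w)) powr p))"
      by (simp add: ennreal_mult[symmetric] ennreal_plus[symmetric] ennreal_leI del: ennreal_plus)
  qed
  also have "\<dots> = ennreal (2 powr p) *
       (transport_cost p (lp_dist p dX dY) \<gamma> + transport_cost p (lp_dist p dY dZ) \<eta>)"
    unfolding \<gamma>_cost \<eta>_cost by (subst nn_integral_cmult, measurable, subst nn_integral_add, measurable)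
  finally have \<pi>_cost: "transport_cost p dY \<pi> \<le> ennreal (2 powr p) *
       (transport_cost p (lp_dist p dX dY) \<gamma> + transport_cost p (lp_dist p dY dZ) \<eta>)" .
  have "AE w in distr \<Omega> borel (\<lambda>w. snd (snd w)). snd w = f (fst w)"
    unfolding \<Omega>\<nu> by (rule graph)
  then have ae: "AE w in \<Omega>. snd (snd (snd w)) = f (fst (snd (snd w)))"
    by (subst (asm) AE_distr_borel[OF \<Omega>]) measurable
  have "transport_cost p (lp_dist p dX (lp_dist p dY dZ)) \<Theta> =
      (\<integral>\<^sup>+w. ennreal (lp_dist p dX (lp_dist p dY dZ) (?\<theta>1 w) (?\<theta>2 w) powr p) \<partial>\<Omega>)"
    unfolding transport_cost_def \<Theta>_def by (subst nn_integral_distr_borel[OF \<Omega> m(6)]) (simp_all, measurable)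
  also have "\<dots> \<le> (\<integral>\<^sup>+w. ennreal (lp_dist p dX dY (fst (fst w)) (snd (fst w), fst (fst (snd w))) powr p) +
      ennreal (2 powr p) * (ennreal (dZ (f (snd (fst (fst w)))) (f (fst (snd (snd w)))) powr p) +
        ennreal (lp_dist p dY dZ (snd (snd w)) (fst (snd w)) powr p)) \<partial>\<Omega>)"
    using ae
  proof (intro nn_integral_mono_AE, eventually_elim)
    fix w :: "(('x \<times> 'y) \<times> 'x) \<times> ('y \<times> 'z) \<times> ('y \<times> 'z)"
    assume w: "snd (snd (snd w)) = f (fst (snd (snd w)))"
    let ?a = "dZ (f (snd (fst (fst w)))) (f (fst (snd (snd w)))) powr p"
      and ?b = "dZ (snd (snd (snd w))) (snd (fst (snd w))) powr p"
    have "dZ (f (snd (fst (fst w)))) (snd (fst (snd w))) powr p \<le> 2 powr p * (?a + ?b)"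
      using Z.quasi_triangle[of p "f (snd (fst (fst w)))" "snd (fst (snd w))" "snd (snd (snd w))"] p by (simp add: w)
    also have "\<dots> \<le> 2 powr p * (?a + lp_dist p dY dZ (snd (snd w)) (fst (snd w)) powr p)"
      by (intro mult_left_mono) (simp_all add: lp_powr)
    finally have "lp_dist p dX (lp_dist p dY dZ) (?\<theta>1 w) (?\<theta>2 w) powr p \<le>
        lp_dist p dX dY (fst (fst w)) (snd (fst w), fst (fst (snd w))) powr p +
        2 powr p * (?a + lp_dist p dY dZ (snd (snd w)) (fst (snd w)) powr p)"
      by (simp add: lp_powr)
    then show "ennreal (lp_dist p dX (lp_dist p dY dZ) (?\<theta>1 w) (?\<theta>2 w) powr p) \<le>
        ennreal (lp_dist p dX dY (fst (fst w)) (snd (fst w), fst (fst (snd w))) powr p) +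
        ennreal (2 powr p) * (ennreal ?a + ennreal (lp_dist p dY dZ (snd (snd w)) (fst (snd w)) powr p))"
      by (simp add: ennreal_mult[symmetric] ennreal_plus[symmetric] ennreal_leI del: ennreal_plus)
  qed
  also have "\<dots> = transport_cost p (lp_dist p dX dY) \<gamma> +
       ennreal (2 powr p) * ((\<integral>\<^sup>+w. ennreal (dZ (f (fst w)) (f (snd w)) powr p) \<partial>\<pi>) +
                             transport_cost p (lp_dist p dY dZ) \<eta>)"
    unfolding \<gamma>_cost \<eta>_cost
    by (subst \<pi>_int, measurable, subst nn_integral_add, measurable,
        subst nn_integral_cmult, measurable, subst nn_integral_add, measurable)
  finally show thesis by (rule that[OF \<Theta> \<pi> \<pi>_cost])
qed

text \<open>
  Both \<open>y\<close> and \<open>y''\<close> have the first marginal of \<open>\<nu>\<close> as law, and they are close on average once \<open>\<gamma>\<close> and \<open>\<eta>\<close>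
  are cheap; so the only term of the cost bound that is not small by itself is handled by the
  stability of \<open>f\<close> under cheap self-couplings.
\<close>

lemma ci_prod_Wp_continuous:
  assumes D: "(\<mu>, \<nu>) \<in> ci_dom p dX dY dZ" and \<nu>: "\<nu> \<in> Fp p dY dZ" and \<epsilon>: "0 < (\<epsilon> :: real)"
  shows "\<exists>\<delta>>0. \<forall>\<mu>' \<nu>'. (\<mu>', \<nu>') \<in> ci_dom p dX dY dZ \<longrightarrow>
    Wp p (lp_dist p dX dY) \<mu> \<mu>' < \<delta> \<longrightarrow> Wp p (lp_dist p dY dZ) \<nu> \<nu>' < \<delta> \<longrightarrow>
    Wp p (lp_dist p dX (lp_dist p dY dZ)) (ci_prod \<mu> \<nu>) (ci_prod \<mu>' \<nu>') < \<epsilon>"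
proof -
  note D' = ci_domD[OF D]
  note [measurable_cong] = borel_probs_sets[OF D'(4)]
  obtain f where f [measurable]: "f \<in> borel \<rightarrow>\<^sub>M borel" and graph: "AE w in \<nu>. snd w = f (fst w)"
    using \<nu> by (auto simp: Fp_def case_prod_unfold)
  define m where "m = distr \<nu> borel fst"
  have m: "m \<in> borel_probs" unfolding m_def by (rule distr_borel_probs[OF D'(4)]) measurable
  define a :: "'y \<times> 'z" where "a = undefined"
  have "(\<integral>\<^sup>+y. ennreal (dZ (snd a) (f y) powr p) \<partial>m) = (\<integral>\<^sup>+w. ennreal (dZ (snd a) (f (fst w)) powr p) \<partial>\<nu>)"
    unfolding m_def by (subst nn_integral_distr_borel[OF D'(4)]) measurable
  also have "\<dots> \<le> (\<integral>\<^sup>+w. ennreal (lp_dist p dY dZ a w powr p) \<partial>\<nu>)"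
    using graph by (intro nn_integral_mono_AE, eventually_elim) (simp add: lp_powr ennreal_leI)
  also have "\<dots> < \<infinity>" by (rule YZ.moment_finite[OF D'(2)])
  finally have fin: "(\<integral>\<^sup>+y. ennreal (dZ (snd a) (f y) powr p) \<partial>m) < \<infinity>" .
  define k :: real where "k = 2 powr p"
  have k: "1 \<le> k" using p by (simp add: k_def ge_one_powr_ge_zero)
  define E where "E = (\<epsilon> / 2) powr p"
  have E: "0 < E" using \<epsilon> by (simp add: E_def)
  obtain \<delta>1 where \<delta>1: "0 < \<delta>1" "\<And>\<pi>. \<pi> \<in> couplings m m \<Longrightarrow> transport_cost p dY \<pi> \<le> ennreal \<delta>1 \<Longrightarrow>
      (\<integral>\<^sup>+w. ennreal (dZ (f (fst w)) (f (snd w)) powr p) \<partial>\<pi>) \<le> ennreal (E / (3 * k))"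
    using Y.coupling_moves_function_small[OF m dZ f fin, of "E / (3 * k)"] E k by auto
  \<comment> \<open>the two arguments make the cost of \<open>\<Theta>\<close> at most \<open>E\<close> and that of \<open>\<pi>\<close> at most \<open>\<delta>1\<close>\<close>
  define t where "t = min (E / (3 * k)) (\<delta>1 / (2 * k))"
  have t: "0 < t" "k * t \<le> E / 3" "t \<le> E / 3" "k * (t + t) \<le> \<delta>1"
  proof -
    show "0 < t" using E k \<delta>1(1) by (simp add: t_def)
    have "t \<le> E / (3 * k)" "t \<le> \<delta>1 / (2 * k)" by (simp_all add: t_def)
    then show 1: "k * t \<le> E / 3" and "k * (t + t) \<le> \<delta>1" using k by (simp_all add: field_simps)
    have "1 * t \<le> k * t" using k \<open>0 < t\<close> by (intro mult_right_mono) auto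
    then show "t \<le> E / 3" using 1 by simp
  qed
  define \<delta> where "\<delta> = t powr (1 / p)"
  have \<delta>: "0 < \<delta>" "\<delta> powr p = t" using t(1) p by (simp_all add: \<delta>_def powr_powr)
  have "Wp p (lp_dist p dX (lp_dist p dY dZ)) (ci_prod \<mu> \<nu>) (ci_prod \<mu>' \<nu>') < \<epsilon>"
    if D2: "(\<mu>', \<nu>') \<in> ci_dom p dX dY dZ" and W: "Wp p (lp_dist p dX dY) \<mu> \<mu>' < \<delta>" "Wp p (lp_dist p dY dZ) \<nu> \<nu>' < \<delta>" for \<mu>' \<nu>'
  proof -
    note D2' = ci_domD[OF D2]
    obtain \<gamma> where \<gamma>: "\<gamma> \<in> couplings \<mu> \<mu>'" "transport_cost p (lp_dist p dX dY) \<gamma> < ennreal (\<delta> powr p)"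
      by (rule XY.Wp_lessE[OF D'(1) D2'(1) W(1)])
    obtain \<eta> where \<eta>: "\<eta> \<in> couplings \<nu> \<nu>'" "transport_cost p (lp_dist p dY dZ) \<eta> < ennreal (\<delta> powr p)"
      by (rule YZ.Wp_lessE[OF D'(2) D2'(2) W(2)])
    have small: "transport_cost p (lp_dist p dX dY) \<gamma> \<le> ennreal t" "transport_cost p (lp_dist p dY dZ) \<eta> \<le> ennreal t"
      using \<gamma>(2) \<eta>(2) by (simp_all add: \<delta>(2) less_imp_le)
    obtain \<Theta> \<pi> where \<Theta>: "\<Theta> \<in> couplings (ci_prod \<mu> \<nu>) (ci_prod \<mu>' \<nu>')"
      and \<pi>: "\<pi> \<in> couplings m m"
      and \<pi>_cost: "transport_cost p dY \<pi> \<le> ennreal k *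
         (transport_cost p (lp_dist p dX dY) \<gamma> + transport_cost p (lp_dist p dY dZ) \<eta>)"
      and \<Theta>_cost: "transport_cost p (lp_dist p dX (lp_dist p dY dZ)) \<Theta> \<le> transport_cost p (lp_dist p dX dY) \<gamma> +
         ennreal k * ((\<integral>\<^sup>+w. ennreal (dZ (f (fst w)) (f (snd w)) powr p) \<partial>\<pi>) + transport_cost p (lp_dist p dY dZ) \<eta>)"
      unfolding m_def k_def by (rule transport_cost_ci_prod_le[OF D D2 f graph \<gamma>(1) \<eta>(1)])
    have "transport_cost p dY \<pi> \<le> ennreal k * (ennreal t + ennreal t)"
      using \<pi>_cost by (rule order.trans) (intro mult_left_mono add_mono small, simp)
    also have "\<dots> = ennreal (k * (t + t))"
      using t(1) k by (simp add: ennreal_mult[symmetric] ennreal_plus[symmetric] del: ennreal_plus)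
    also have "\<dots> \<le> ennreal \<delta>1" by (rule ennreal_leI[OF t(4)])
    finally have f_small: "(\<integral>\<^sup>+w. ennreal (dZ (f (fst w)) (f (snd w)) powr p) \<partial>\<pi>) \<le> ennreal (E / (3 * k))"
      by (rule \<delta>1(2)[OF \<pi>])
    have "transport_cost p (lp_dist p dX (lp_dist p dY dZ)) \<Theta> \<le> ennreal t + ennreal k * (ennreal (E / (3 * k)) + ennreal t)"
      using \<Theta>_cost by (rule order.trans) (intro mult_left_mono add_mono small f_small, simp)
    also have "\<dots> = ennreal (t + k * (E / (3 * k) + t))"
      using t(1) k E by (simp add: ennreal_mult[symmetric] ennreal_plus[symmetric] del: ennreal_plus)
    also have "\<dots> \<le> ennreal ((\<epsilon> / 2) powr p)"
      unfolding E_def[symmetric] using t k by (intro ennreal_leI) (simp add: distrib_left)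
    finally have "Wp p (lp_dist p dX (lp_dist p dY dZ)) (ci_prod \<mu> \<nu>) (ci_prod \<mu>' \<nu>') \<le> \<epsilon> / 2"
      by (rule XYZ.Wp_le[OF \<Theta>]) (use \<epsilon> in simp)
    then show ?thesis using \<epsilon> by simp
  qed
  then show ?thesis using \<delta>(1) by blast
qed

lemma ci_prod_topcontinuous_at:
  assumes D: "(\<mu>, \<nu>) \<in> ci_dom p dX dY dZ" and \<nu>: "\<nu> \<in> Fp p dY dZ"
  shows "topcontinuous_at
           (subtopology (prod_topology (Wp_topology p (lp_dist p dX dY)) (Wp_topology p (lp_dist p dY dZ)))
             (ci_dom p dX dY dZ))
           (Wp_topology p (lp_dist p dX (lp_dist p dY dZ)))
           (\<lambda>(\<mu>', \<nu>'). ci_prod \<mu>' \<nu>') (\<mu>, \<nu>)"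
proof -
  interpret XY: Metric_space "Pp p (lp_dist p dX dY)" "Wp p (lp_dist p dX dY)" by (rule XY.Metric_space_Wp)
  interpret YZ: Metric_space "Pp p (lp_dist p dY dZ)" "Wp p (lp_dist p dY dZ)" by (rule YZ.Metric_space_Wp)
  interpret XYZ: Metric_space "Pp p (lp_dist p dX (lp_dist p dY dZ))" "Wp p (lp_dist p dX (lp_dist p dY dZ))"
    by (rule XYZ.Metric_space_Wp)
  let ?S = "subtopology (prod_topology XY.mtopology YZ.mtopology) (ci_dom p dX dY dZ)"
  have top: "topspace ?S = ci_dom p dX dY dZ"
    by (auto dest: ci_domD)
  show ?thesis
    unfolding topcontinuous_at_def Wp_topology_def
  proof (intro conjI allI impI)
    show "(\<mu>, \<nu>) \<in> topspace ?S" unfolding top by (rule D)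
    show "(\<lambda>(\<mu>', \<nu>'). ci_prod \<mu>' \<nu>') \<in> topspace ?S \<rightarrow> topspace XYZ.mtopology"
      unfolding top XYZ.topspace_mtopology using ci_prod_in_Pp by auto
    fix V assume "openin XYZ.mtopology V \<and> (case (\<mu>, \<nu>) of (\<mu>', \<nu>') \<Rightarrow> ci_prod \<mu>' \<nu>') \<in> V"
    then obtain \<epsilon> where \<epsilon>: "0 < \<epsilon>" "XYZ.mball (ci_prod \<mu> \<nu>) \<epsilon> \<subseteq> V"
      unfolding XYZ.openin_mtopology by auto
    obtain \<delta> where \<delta>: "0 < \<delta>" "\<And>\<mu>' \<nu>'. (\<mu>', \<nu>') \<in> ci_dom p dX dY dZ \<Longrightarrow>
        Wp p (lp_dist p dX dY) \<mu> \<mu>' < \<delta> \<Longrightarrow> Wp p (lp_dist p dY dZ) \<nu> \<nu>' < \<delta> \<Longrightarrow>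
        Wp p (lp_dist p dX (lp_dist p dY dZ)) (ci_prod \<mu> \<nu>) (ci_prod \<mu>' \<nu>') < \<epsilon>"
      using ci_prod_Wp_continuous[OF D \<nu> \<epsilon>(1)] by blast
    let ?U = "(XY.mball \<mu> \<delta> \<times> YZ.mball \<nu> \<delta>) \<inter> ci_dom p dX dY dZ"
    have "openin ?S ?U"
      by (intro openin_subtopology_Int) (simp add: openin_prod_Times_iff)
    moreover have "(\<mu>, \<nu>) \<in> ?U" using D \<delta>(1) by (auto dest: ci_domD)
    moreover have "\<forall>w\<in>?U. (case w of (\<mu>', \<nu>') \<Rightarrow> ci_prod \<mu>' \<nu>') \<in> V"
      using \<epsilon>(2) \<delta>(2) ci_prod_in_Pp[OF D] ci_prod_in_Pp by (auto simp: subset_iff)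
    ultimately show "\<exists>U. openin ?S U \<and> (\<mu>, \<nu>) \<in> U \<and> (\<forall>w\<in>U. (case w of (\<mu>', \<nu>') \<Rightarrow> ci_prod \<mu>' \<nu>') \<in> V)"
      by blast
  qed
qed

end

theorem theorem4p1:
  fixes p :: real
    and \<mu> :: "('x::polish_space \<times> 'y::polish_space) measure"
    and \<nu> :: "('y \<times> 'z::polish_space) measure"
  assumes "1 \<le> p"
    and "(\<mu>, \<nu>) \<in> ci_dom p dist dist dist"
    and "\<nu> \<in> Fp p dist dist"
  shows "topcontinuous_at
           (subtopology
             (prod_topology (Wp_topology p (lp_dist p dist dist))
                            (Wp_topology p (lp_dist p dist dist)))
             (ci_dom p dist dist dist))
           (Wp_topology p (lp_dist p dist (lp_dist p dist dist)))
           (\<lambda>(\<mu>', \<nu>'). ci_prod \<mu>' \<nu>')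
           (\<mu>, \<nu>)"
  using assms
  by (rule ci_prod_topcontinuous_at[OF _ compatible_metric_dist compatible_metric_dist compatible_metric_dist])

end
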